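(* Let $f=(f_1,\ldots,f_m)$ be a contractive free holomorphic function with $\|f(0)\|<1$ such that the boundary functions $\widetilde f_1,\ldots,\widetilde f_m$ are in the noncommutative disc algebra $\mathcal A_n$. Then $$d_K(f(A),f(B))\le\frac{1+\|f(0)\|}{1-\|f(0)\|}\,d_K(A,B)$$ for any $n$-tuples $A=(A_1,\ldots,A_n)$ and $B=(B_1,\ldots,B_n)$ in $[\mathcal C_\infty]_{<1}$.
   Context: Let $n,m\ge1$, $\mathcal H$ a complex Hilbert space, $\mathcal K$ a separable infinite-dimensional Hilbert space. $\mathbb F_n^+$ is the unital free semigroup on generators $g_1,\ldots,g_n$ with identity $g_0$; $|\alpha|$ is the length of $\alpha$. $X_\alpha:=X_{i_1}\cdots X_{i_k}$ if $\alpha=g_{i_1}\cdots g_{i_k}$, $X_{g_0}:=I$. For any number $n$ of operators, the joint spectral radius is $r(X):=\lim_{k\to\infty}\|\sum_{|\alpha|=k}X_\alpha X_\alpha^*\|^{1/2k}$ and $[\mathcal C_\infty]_{<1}:=\{X\in B(\mathcal H)^n:r(X)<1\}$ (for $m$-tuples, the corresponding subset of $B(\mathcal H)^m$). $[B(\mathcal K)^n]_1:=\{X\in B(\mathcal K)^n:\|\sum_iX_iX_i^*\|<1\}$. For $A,B\in[\mathcal C_\infty]_{<1}$, $d_K(A,B):=\sup_p\|\Re p(A)-\Re p(B)\|$, the supremum over all noncommutative polynomials $p\in\mathbb C[X_1,\ldots,X_n]\otimes M_k$, $k\in\mathbb N$, with $\Re p(0)=I$ and $\Re p(X):=\frac12(p(X)^*+p(X))\ge0$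 for all $X\in[B(\mathcal K)^n]_1$; here $p(A)=\sum_\alpha A_\alpha\otimes M_\alpha$ for $p=\sum_\alpha X_\alpha\otimes M_\alpha$. On $m$-tuples $d_K$ is defined in the same way with $m$ variables. Each $f_j(X)=\sum_{k=0}^\infty\sum_{|\alpha|=k}a_\alpha^{(j)}X_\alpha$ ($a^{(j)}_\alpha\in\mathbb C$, $\limsup_k(\sum_{|\alpha|=k}|a_\alpha^{(j)}|^2)^{1/2k}\le1$) is a free holomorphic function on $[B(\mathcal K)^n]_1$; $f$ is contractive if the row operator $[f_1(X)\ \cdots\ f_m(X)]$ has norm at most $1$ for all $X\in[B(\mathcal K)^n]_1$. $f(0)=(f_1(0),\ldots,f_m(0))$ has norm the Euclidean norm in $\mathbb C^m$. $S_i\varphi:=e_i\otimes\varphi$ are the left creation operators on the full Fock space $F^2(H_n)=\mathbb C1\oplus\bigoplus_{k\ge1}H_n^{\otimes k}$ ($e_1,\ldots,e_n$ an orthonormal basis of the $n$-dimensional Hilbert space $H_n$), and $\mathcal A_n$ is the norm closed algebra generated by $S_1,\ldots,S_n,I$. The boundary function of $f_j$ is $\widetilde f_j=\lim_{r\to1}f_j(rS_1,\ldots,rS_n)$; $\widetilde f_j\in\mathcal A_n$ means that this limit exists in operator norm. For $A$ with $r(A)<1$, $f(A)=(f_1(A),\ldots,f_m(A))$ with $f_j(A)=\sum_{k=0}^\infty\sum_{|\alpha|=k}a_\alpha^{(j)}A_\alpha$ (norm convergent in $k$); $f(A)$ is an $m$-tuple with joint spectral radius $<1$. *)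

theory Defs
  imports "HOL-Analysis.Analysis"
begin

section \<open>Complex Hilbert spaces\<close>

text \<open>The inner product is linear in the first argument.\<close>

class complex_inner = real_normed_vector +
  fixes scaleC :: "complex \<Rightarrow> 'a \<Rightarrow> 'a"  (infixr \<open>*\<^sub>C\<close> 75)
    and cinner :: "'a \<Rightarrow> 'a \<Rightarrow> complex"
  assumes scaleC_add_right: "c *\<^sub>C (x + y) = c *\<^sub>C x + c *\<^sub>C y"
    and scaleC_add_left: "(c + d) *\<^sub>C x = c *\<^sub>C x + d *\<^sub>C x"
    and scaleC_scaleC: "c *\<^sub>C d *\<^sub>C x = (c * d) *\<^sub>C x"
    and scaleR_scaleC: "r *\<^sub>R x = complex_of_real r *\<^sub>C x"
    and cinner_commute: "cinner x y = cnj (cinner y x)"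
    and cinner_add_left: "cinner (x + y) z = cinner x z + cinner y z"
    and cinner_scaleC_left: "cinner (c *\<^sub>C x) y = c * cinner x y"
    and cinner_self: "cinner x x = complex_of_real ((norm x)\<^sup>2)"

class chilbert_space = complex_inner + complete_space

lemma norm_scaleC:
  fixes x :: "'a :: complex_inner"
  shows "norm (c *\<^sub>C x) = cmod c * norm x"
proof -
  have "complex_of_real ((norm (c *\<^sub>C x))\<^sup>2) = c * cnj (c * cinner x x)"
    by (metis cinner_self cinner_scaleC_left cinner_commute)
  also have "\<dots> = complex_of_real ((cmod c * norm x)\<^sup>2)"
    by (simp add: cinner_self complex_norm_square power_mult_distrib flip: of_real_power)
  finally have "(norm (c *\<^sub>C x))\<^sup>2 = (cmod c * norm x)\<^sup>2"
    using of_real_eq_iff by blast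
  then show ?thesis
    by (simp add: power2_eq_iff_nonneg)
qed

lemma bounded_linear_scaleC: "bounded_linear (\<lambda>x :: 'a :: complex_inner. c *\<^sub>C x)"
proof (rule bounded_linear_intro[where K = "cmod c"])
  show "c *\<^sub>C (r *\<^sub>R x) = r *\<^sub>R c *\<^sub>C x" for r and x :: 'a
    by (simp add: scaleR_scaleC scaleC_scaleC mult.commute)
qed (simp_all add: scaleC_add_right norm_scaleC mult.commute)

section \<open>Bounded operators\<close>

text \<open>\<open>'a \<Rightarrow>\<^sub>L 'b\<close> is the space of bounded real-linear maps with the operator norm; the
  bounded operators of the Hilbert space are its complex-linear elements.\<close>

definition bounded_ops :: "('a::complex_inner \<Rightarrow>\<^sub>L 'b::complex_inner) set" where
  "bounded_ops = {T :: 'a \<Rightarrow>\<^sub>L 'b. \<forall>c x. T (c *\<^sub>C x) = c *\<^sub>C T x}"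

lift_definition scaleC_op :: "complex \<Rightarrow> ('a::real_normed_vector \<Rightarrow>\<^sub>L 'b::complex_inner) \<Rightarrow> ('a \<Rightarrow>\<^sub>L 'b)"
  is "\<lambda>c T x. c *\<^sub>C T x"
  by (rule bounded_linear_compose[OF bounded_linear_scaleC])

definition adj :: "('a::chilbert_space \<Rightarrow>\<^sub>L 'b::chilbert_space) \<Rightarrow> ('b \<Rightarrow>\<^sub>L 'a)" where
  "adj T = (THE S :: 'b \<Rightarrow>\<^sub>L 'a. \<forall>x y. cinner (T x) y = cinner x (S y))"

text \<open>A tuple is a function on a finite index type, and the free semigroup on \<open>'n\<close> is the type
  \<open>'n list\<close> of words. \<open>op_word X w\<close> is \<open>X\<^sub>w\<close>.\<close>

primrec op_word :: "('n \<Rightarrow> 'a \<Rightarrow>\<^sub>L 'a) \<Rightarrow> 'n list \<Rightarrow> ('a::real_normed_vector \<Rightarrow>\<^sub>L 'a)" where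
  "op_word X [] = id_blinfun"
| "op_word X (i # w) = X i o\<^sub>L op_word X w"

definition joint_spectral_radius :: "('n::finite \<Rightarrow> 'h::chilbert_space \<Rightarrow>\<^sub>L 'h) \<Rightarrow> real" where
  "joint_spectral_radius X =
     lim (\<lambda>k. root (2 * k) (norm (\<Sum>w | length w = k. op_word X w o\<^sub>L adj (op_word X w))))"

definition C_inf_lt1 :: "('n::finite \<Rightarrow> 'h::chilbert_space \<Rightarrow>\<^sub>L 'h) set" where
  "C_inf_lt1 = {X. (\<forall>i. X i \<in> bounded_ops) \<and> joint_spectral_radius X < 1}"

definition row_ball :: "('n::finite \<Rightarrow> 'k::chilbert_space \<Rightarrow>\<^sub>L 'k) set" where
  "row_ball = {X. (\<forall>i. X i \<in> bounded_ops) \<and> norm (\<Sum>i\<in>UNIV. X i o\<^sub>L adj (X i)) < 1}"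

definition infinite_dimensional :: "'k::complex_inner itself \<Rightarrow> bool" where
  "infinite_dimensional _ \<longleftrightarrow> (\<forall>B :: 'k set. finite B \<longrightarrow> module.span scaleC B \<noteq> UNIV)"

section \<open>Noncommutative polynomials with matrix coefficients\<close>

text \<open>An element of \<open>B(H) \<otimes> M\<^sub>k\<close> is a \<open>k \<times> k\<close> operator matrix \<open>T i j\<close> with \<open>i, j < k\<close> (entries
  outside this range are irrelevant), acting on \<open>H \<otimes> \<complex>\<^sup>k = H\<^sup>k\<close> with the Hilbert space norm. A
  polynomial \<open>\<Sum>\<^sub>w X\<^sub>w \<otimes> M\<^sub>w\<close> is given by its coefficient matrices \<open>M w\<close>.\<close>

type_synonym 'a op_matrix = "nat \<Rightarrow> nat \<Rightarrow> ('a \<Rightarrow>\<^sub>L 'a)"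

definition op_matrix_norm :: "nat \<Rightarrow> 'a::complex_inner op_matrix \<Rightarrow> real" where
  "op_matrix_norm k T =
     Sup {sqrt (\<Sum>i<k. (norm (\<Sum>j<k. T i j (x j)))\<^sup>2) | x. (\<Sum>j<k. (norm (x j))\<^sup>2) \<le> 1}"

definition op_matrix_nonneg :: "nat \<Rightarrow> 'a::complex_inner op_matrix \<Rightarrow> bool" where
  "op_matrix_nonneg k T \<longleftrightarrow>
     (\<forall>x. (\<Sum>i<k. cinner (\<Sum>j<k. T i j (x j)) (x i)) \<in> \<real>\<^sub>\<ge>\<^sub>0)"

definition op_matrix_Re :: "'a::chilbert_space op_matrix \<Rightarrow> 'a op_matrix" where
  "op_matrix_Re T = (\<lambda>i j. (1/2) *\<^sub>R (adj (T j i) + T i j))"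

definition nc_poly :: "nat \<Rightarrow> ('n list \<Rightarrow> nat \<Rightarrow> nat \<Rightarrow> complex) \<Rightarrow> bool" where
  "nc_poly k M \<longleftrightarrow> finite {w. \<exists>i<k. \<exists>j<k. M w i j \<noteq> 0}"

definition nc_poly_eval ::
  "('n list \<Rightarrow> nat \<Rightarrow> nat \<Rightarrow> complex) \<Rightarrow> ('n \<Rightarrow> 'a::complex_inner \<Rightarrow>\<^sub>L 'a) \<Rightarrow> 'a op_matrix" where
  "nc_poly_eval M X = (\<lambda>i j. \<Sum>w | M w i j \<noteq> 0. scaleC_op (M w i j) (op_word X w))"

definition nc_poly_Re ::
  "('n list \<Rightarrow> nat \<Rightarrow> nat \<Rightarrow> complex) \<Rightarrow> ('n \<Rightarrow> 'a::chilbert_space \<Rightarrow>\<^sub>L 'a) \<Rightarrow> 'a op_matrix" where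
  "nc_poly_Re M X = op_matrix_Re (nc_poly_eval M X)"

definition test_polys ::
  "'k::chilbert_space itself \<Rightarrow> (nat \<times> ('n::finite list \<Rightarrow> nat \<Rightarrow> nat \<Rightarrow> complex)) set" where
  "test_polys _ = {(k, M). 0 < k \<and> nc_poly k M \<and>
     (\<forall>i<k. \<forall>j<k. nc_poly_Re M (\<lambda>_. 0 :: 'k \<Rightarrow>\<^sub>L 'k) i j = (if i = j then id_blinfun else 0)) \<and>
     (\<forall>X \<in> (row_ball :: ('n \<Rightarrow> 'k \<Rightarrow>\<^sub>L 'k) set). op_matrix_nonneg k (nc_poly_Re M X))}"

text \<open>The supremum is taken in \<open>[0, \<infinity>]\<close>.\<close>

definition d_K :: "'k::chilbert_space itself \<Rightarrow>
    ('n::finite \<Rightarrow> 'h::chilbert_space \<Rightarrow>\<^sub>L 'h) \<Rightarrow> ('n \<Rightarrow> 'h \<Rightarrow>\<^sub>L 'h) \<Rightarrow> ennreal" where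
  "d_K K A B = (SUP (k, M) \<in> test_polys K.
     ennreal (op_matrix_norm k (\<lambda>i j. nc_poly_Re M A i j - nc_poly_Re M B i j)))"

section \<open>Free holomorphic functions\<close>

definition free_holomorphic :: "('n::finite list \<Rightarrow> complex) \<Rightarrow> bool" where
  "free_holomorphic a \<longleftrightarrow>
     limsup (\<lambda>k. ereal (root (2 * k) (\<Sum>w | length w = k. (cmod (a w))\<^sup>2))) \<le> 1"

definition fh_eval ::
  "('n::finite list \<Rightarrow> complex) \<Rightarrow> ('n \<Rightarrow> 'a::complex_inner \<Rightarrow>\<^sub>L 'a) \<Rightarrow> ('a \<Rightarrow>\<^sub>L 'a)" where
  "fh_eval a X = (\<Sum>k. \<Sum>w | length w = k. scaleC_op (a w) (op_word X w))"

definition fh_map :: "('m \<Rightarrow> 'n::finite list \<Rightarrow> complex) \<Rightarrow>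
    ('n \<Rightarrow> 'a::complex_inner \<Rightarrow>\<^sub>L 'a) \<Rightarrow> ('m \<Rightarrow> 'a \<Rightarrow>\<^sub>L 'a)" where
  "fh_map a X = (\<lambda>j. fh_eval (a j) X)"

text \<open>\<open>f(0)\<close> as a vector of \<open>\<complex>\<^sup>m\<close>; the norm of \<open>complex ^ 'm\<close> is the Euclidean one.\<close>

definition fh_at_0 :: "('m::finite \<Rightarrow> 'n list \<Rightarrow> complex) \<Rightarrow> complex ^ 'm" where
  "fh_at_0 a = (\<chi> j. a j [])"

text \<open>\<open>'k ^ 'm\<close> carries the Hilbert space norm of the direct sum of copies of \<open>'k\<close>, so the
  \<open>onorm\<close> is the norm of the row operator.\<close>

definition contractive :: "'k::chilbert_space itself \<Rightarrow> ('m::finite \<Rightarrow> 'n::finite list \<Rightarrow> complex) \<Rightarrow> bool" where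
  "contractive _ a \<longleftrightarrow> (\<forall>X \<in> (row_ball :: ('n \<Rightarrow> 'k \<Rightarrow>\<^sub>L 'k) set).
     onorm (\<lambda>x :: 'k ^ 'm. \<Sum>j\<in>UNIV. fh_map a X j (x $ j)) \<le> 1)"

section \<open>Square-summable families\<close>

typedef 'a ell2 = "{f :: 'a \<Rightarrow> complex. (\<lambda>x. (cmod (f x))\<^sup>2) summable_on UNIV}"
  morphisms ell2_fun Abs_ell2
  by (rule exI[of _ "\<lambda>_. 0"]) simp

setup_lifting type_definition_ell2

lemma ell2_summable: "(\<lambda>x. (cmod (ell2_fun f x))\<^sup>2) summable_on UNIV"
  using ell2_fun[of f] by simp

lemma ell2_boundI:
  fixes f :: "'a \<Rightarrow> complex"
  assumes "\<And>F. finite F \<Longrightarrow> L2_set (\<lambda>x. cmod (f x)) F \<le> C"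
  shows "(\<lambda>x. (cmod (f x))\<^sup>2) summable_on UNIV"
    and "sqrt (\<Sum>\<^sub>\<infinity>x. (cmod (f x))\<^sup>2) \<le> C"
proof -
  have C: "0 \<le> C"
    using assms[of "{}"] by simp
  have le: "(\<Sum>x\<in>F. (cmod (f x))\<^sup>2) \<le> C\<^sup>2" if "finite F" for F
    using assms[OF that] by (simp add: L2_set_def sqrt_le_D)
  show sm: "(\<lambda>x. (cmod (f x))\<^sup>2) summable_on UNIV"
    by (rule nonneg_bdd_above_summable_on) (auto intro!: bdd_aboveI[where M = "C\<^sup>2"] le)
  have "(\<Sum>\<^sub>\<infinity>x. (cmod (f x))\<^sup>2) \<le> C\<^sup>2"
    by (rule infsum_le_finite_sums[OF sm le])
  then show "sqrt (\<Sum>\<^sub>\<infinity>x. (cmod (f x))\<^sup>2) \<le> C"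
    using C real_le_lsqrt by blast
qed

lemma L2_set_le_ell2:
  assumes "(\<lambda>x. (cmod (f x))\<^sup>2) summable_on UNIV" "finite F"
  shows "L2_set (\<lambda>x. cmod (f x)) F \<le> sqrt (\<Sum>\<^sub>\<infinity>x. (cmod (f x))\<^sup>2)"
  unfolding L2_set_def using finite_sum_le_infsum[OF assms(1,2)] by simp

lemma ell2_add:
  assumes "(\<lambda>x. (cmod (f x))\<^sup>2) summable_on UNIV" "(\<lambda>x. (cmod (g x))\<^sup>2) summable_on UNIV"
  shows "(\<lambda>x. (cmod (f x + g x))\<^sup>2) summable_on UNIV"
    and "sqrt (\<Sum>\<^sub>\<infinity>x. (cmod (f x + g x))\<^sup>2)
           \<le> sqrt (\<Sum>\<^sub>\<infinity>x. (cmod (f x))\<^sup>2) + sqrt (\<Sum>\<^sub>\<infinity>x. (cmod (g x))\<^sup>2)"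
proof -
  have *: "L2_set (\<lambda>x. cmod (f x + g x)) F
          \<le> sqrt (\<Sum>\<^sub>\<infinity>x. (cmod (f x))\<^sup>2) + sqrt (\<Sum>\<^sub>\<infinity>x. (cmod (g x))\<^sup>2)" if "finite F" for F
  proof -
    have "L2_set (\<lambda>x. cmod (f x + g x)) F \<le> L2_set (\<lambda>x. cmod (f x) + cmod (g x)) F"
      by (intro L2_set_mono norm_triangle_ineq norm_ge_zero)
    also have "\<dots> \<le> L2_set (\<lambda>x. cmod (f x)) F + L2_set (\<lambda>x. cmod (g x)) F"
      by (rule L2_set_triangle_ineq)
    also have "\<dots> \<le> sqrt (\<Sum>\<^sub>\<infinity>x. (cmod (f x))\<^sup>2) + sqrt (\<Sum>\<^sub>\<infinity>x. (cmod (g x))\<^sup>2)"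
      by (intro add_mono L2_set_le_ell2 assms that)
    finally show ?thesis .
  qed
  from ell2_boundI[OF *] show "(\<lambda>x. (cmod (f x + g x))\<^sup>2) summable_on UNIV"
    and "sqrt (\<Sum>\<^sub>\<infinity>x. (cmod (f x + g x))\<^sup>2)
           \<le> sqrt (\<Sum>\<^sub>\<infinity>x. (cmod (f x))\<^sup>2) + sqrt (\<Sum>\<^sub>\<infinity>x. (cmod (g x))\<^sup>2)"
    by auto
qed

lemma ell2_scale:
  assumes "(\<lambda>x. (cmod (f x))\<^sup>2) summable_on UNIV"
  shows "(\<lambda>x. (cmod (c * f x))\<^sup>2) summable_on UNIV"
  using summable_on_cmult_right[OF assms, of "(cmod c)\<^sup>2"]
  by (simp add: norm_mult power_mult_distrib)

lemma ell2_inner_summable: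
  assumes "(\<lambda>x. (cmod (f x))\<^sup>2) summable_on UNIV" "(\<lambda>x. (cmod (g x))\<^sup>2) summable_on UNIV"
  shows "(\<lambda>x. f x * cnj (g x)) summable_on UNIV"
proof (rule abs_summable_summable[OF Infinite_Sum.abs_summable_on_comparison_test'])
  show "(\<lambda>x. (cmod (f x))\<^sup>2 + (cmod (g x))\<^sup>2) summable_on UNIV"
    by (rule summable_on_add[OF assms])
  show "norm (f x * cnj (g x)) \<le> (cmod (f x))\<^sup>2 + (cmod (g x))\<^sup>2" for x
  proof -
    have "2 * (cmod (f x) * cmod (g x)) \<le> (cmod (f x))\<^sup>2 + (cmod (g x))\<^sup>2"
      using sum_squares_bound[of "cmod (f x)" "cmod (g x)"] by (simp add: mult.assoc)
    moreover have "0 \<le> cmod (f x) * cmod (g x)"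
      by simp
    ultimately show ?thesis
      unfolding norm_mult complex_mod_cnj by linarith
  qed
qed

instantiation ell2 :: (type) complex_inner
begin

lift_definition zero_ell2 :: "'a ell2" is "\<lambda>_. 0"
  by simp
lift_definition plus_ell2 :: "'a ell2 \<Rightarrow> 'a ell2 \<Rightarrow> 'a ell2" is "\<lambda>f g x. f x + g x"
  by (rule ell2_add)
lift_definition uminus_ell2 :: "'a ell2 \<Rightarrow> 'a ell2" is "\<lambda>f x. - f x"
  by simp
lift_definition minus_ell2 :: "'a ell2 \<Rightarrow> 'a ell2 \<Rightarrow> 'a ell2" is "\<lambda>f g x. f x - g x"
  subgoal for f g using ell2_add(1)[of f "\<lambda>x. - g x"] by simp
  done
lift_definition scaleC_ell2 :: "complex \<Rightarrow> 'a ell2 \<Rightarrow> 'a ell2" is "\<lambda>c f x. c * f x"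
  by (rule ell2_scale)
lift_definition scaleR_ell2 :: "real \<Rightarrow> 'a ell2 \<Rightarrow> 'a ell2" is "\<lambda>r f x. complex_of_real r * f x"
  by (rule ell2_scale)
lift_definition norm_ell2 :: "'a ell2 \<Rightarrow> real" is "\<lambda>f. sqrt (\<Sum>\<^sub>\<infinity>x. (cmod (f x))\<^sup>2)" .
lift_definition cinner_ell2 :: "'a ell2 \<Rightarrow> 'a ell2 \<Rightarrow> complex" is "\<lambda>f g. \<Sum>\<^sub>\<infinity>x. f x * cnj (g x)" .
definition dist_ell2 :: "'a ell2 \<Rightarrow> 'a ell2 \<Rightarrow> real" where
  "dist_ell2 f g = norm (f - g)"
definition sgn_ell2 :: "'a ell2 \<Rightarrow> 'a ell2" where
  "sgn_ell2 f = inverse (norm f) *\<^sub>R f"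
definition uniformity_ell2 :: "('a ell2 \<times> 'a ell2) filter" where
  "uniformity_ell2 = (INF e\<in>{0 <..}. principal {(x, y). dist x y < e})"
definition open_ell2 :: "'a ell2 set \<Rightarrow> bool" where
  "open_ell2 U \<longleftrightarrow> (\<forall>x\<in>U. eventually (\<lambda>(x', y). x' = x \<longrightarrow> y \<in> U) uniformity)"

instance
proof
  fix f g h :: "'a ell2" and r s :: real and c d :: complex and U :: "'a ell2 set"
  show "f + g + h = f + (g + h)" "f + g = g + f" "0 + f = f" "- f + f = 0" "f - g = f + - g"
    by (transfer, simp add: fun_eq_iff)+
  show "r *\<^sub>R (f + g) = r *\<^sub>R f + r *\<^sub>R g" "(r + s) *\<^sub>R f = r *\<^sub>R f + s *\<^sub>R f"
    "r *\<^sub>R s *\<^sub>R f = (r * s) *\<^sub>R f" "1 *\<^sub>R f = f"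
    by (transfer, simp add: fun_eq_iff algebra_simps)+
  show "c *\<^sub>C (f + g) = c *\<^sub>C f + c *\<^sub>C g" "(c + d) *\<^sub>C f = c *\<^sub>C f + d *\<^sub>C f"
    "c *\<^sub>C d *\<^sub>C f = (c * d) *\<^sub>C f" "r *\<^sub>R f = complex_of_real r *\<^sub>C f"
    by (transfer, simp add: fun_eq_iff algebra_simps)+
  show "dist f g = norm (f - g)" "sgn f = inverse (norm f) *\<^sub>R f"
    "uniformity = (INF e\<in>{0 <..}. principal {(x, y :: 'a ell2). dist x y < e})"
    "open U \<longleftrightarrow> (\<forall>x\<in>U. \<forall>\<^sub>F (x', y) in uniformity. x' = x \<longrightarrow> y \<in> U)"
    by (rule dist_ell2_def sgn_ell2_def uniformity_ell2_def open_ell2_def)+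
  show "norm f = 0 \<longleftrightarrow> f = 0"
  proof transfer
    fix f :: "'a \<Rightarrow> complex"
    assume f: "(\<lambda>x. (cmod (f x))\<^sup>2) summable_on UNIV"
    show "sqrt (\<Sum>\<^sub>\<infinity>x. (cmod (f x))\<^sup>2) = 0 \<longleftrightarrow> f = (\<lambda>_. 0)"
    proof
      assume 0: "sqrt (\<Sum>\<^sub>\<infinity>x. (cmod (f x))\<^sup>2) = 0"
      show "f = (\<lambda>_. 0)"
      proof
        show "f x = 0" for x
          using L2_set_le_ell2[OF f, of "{x}"] unfolding 0 by simp
      qed
    qed simp
  qed
  show "norm (f + g) \<le> norm f + norm g"
    by transfer (rule ell2_add)
  show "norm (r *\<^sub>R f) = \<bar>r\<bar> * norm f"
    by transfer
      (simp add: norm_mult power_mult_distrib infsum_cmult_right' real_sqrt_mult)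
  show "cinner f g = cnj (cinner g f)"
    by transfer (simp add: mult.commute flip: infsum_cnj)
  show "cinner (f + g) h = cinner f h + cinner g h"
    by transfer (simp add: distrib_right infsum_add ell2_inner_summable)
  show "cinner (c *\<^sub>C f) g = c * cinner f g"
    by transfer (simp add: mult.assoc infsum_cmult_right')
  show "cinner f f = complex_of_real ((norm f)\<^sup>2)"
  proof transfer
    fix f :: "'a \<Rightarrow> complex"
    assume "(\<lambda>x. (cmod (f x))\<^sup>2) summable_on UNIV"
    then have "((\<lambda>x. complex_of_real ((cmod (f x))\<^sup>2)) has_sum
        complex_of_real (\<Sum>\<^sub>\<infinity>x. (cmod (f x))\<^sup>2)) UNIV"
      by (intro has_sum_of_real has_sum_infsum)
    then have "(\<Sum>\<^sub>\<infinity>x. f x * cnj (f x)) = complex_of_real (\<Sum>\<^sub>\<infinity>x. (cmod (f x))\<^sup>2)"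
      unfolding complex_norm_square by (rule infsumI)
    then show "(\<Sum>\<^sub>\<infinity>x. f x * cnj (f x)) =
        complex_of_real ((sqrt (\<Sum>\<^sub>\<infinity>x. (cmod (f x))\<^sup>2))\<^sup>2)"
      by (simp only: real_sqrt_pow2 infsum_nonneg zero_le_power2)
  qed
qed

end

lemma L2_set_le_norm_ell2:
  assumes "finite F" shows "L2_set (\<lambda>x. cmod (ell2_fun f x)) F \<le> norm f"
  unfolding norm_ell2.rep_eq by (rule L2_set_le_ell2[OF ell2_summable assms])

instance ell2 :: (type) chilbert_space
proof
  fix X :: "nat \<Rightarrow> 'a ell2"
  assume X: "Cauchy X"
  have coord: "cmod (ell2_fun f x - ell2_fun g x) \<le> norm (f - g)" for f g :: "'a ell2" and x
    using L2_set_le_norm_ell2[of "{x}" "f - g"] by (simp add: minus_ell2.rep_eq)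
  have "convergent (\<lambda>n. ell2_fun (X n) x)" for x
  proof (rule Cauchy_convergent, rule metric_CauchyI)
    fix e :: real assume "0 < e"
    then obtain N where "\<forall>m\<ge>N. \<forall>n\<ge>N. dist (X m) (X n) < e"
      using metric_CauchyD[OF X] by blast
    then show "\<exists>N. \<forall>m\<ge>N. \<forall>n\<ge>N. dist (ell2_fun (X m) x) (ell2_fun (X n) x) < e"
      using coord by (metis dist_norm le_less_trans)
  qed
  then obtain l where l: "\<And>x. (\<lambda>n. ell2_fun (X n) x) \<longlonglongrightarrow> l x"
    unfolding convergent_def by metis
  have close: "\<exists>N. \<forall>n\<ge>N. \<forall>F. finite F \<longrightarrow> L2_set (\<lambda>x. cmod (ell2_fun (X n) x - l x)) F \<le> e"
    if "0 < e" for e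
  proof -
    obtain N where N: "\<And>m n. m \<ge> N \<Longrightarrow> n \<ge> N \<Longrightarrow> dist (X m) (X n) < e"
      using metric_CauchyD[OF X \<open>0 < e\<close>] by blast
    have "L2_set (\<lambda>x. cmod (ell2_fun (X n) x - l x)) F \<le> e" if "n \<ge> N" "finite F" for n F
    proof (rule Lim_bounded)
      show "(\<lambda>m. L2_set (\<lambda>x. cmod (ell2_fun (X n) x - ell2_fun (X m) x)) F)
              \<longlonglongrightarrow> L2_set (\<lambda>x. cmod (ell2_fun (X n) x - l x)) F"
        unfolding L2_set_def by (intro tendsto_intros l)
      show "\<forall>m\<ge>N. L2_set (\<lambda>x. cmod (ell2_fun (X n) x - ell2_fun (X m) x)) F \<le> e"
      proof (intro allI impI)
        fix m assume "m \<ge> N"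
        have "L2_set (\<lambda>x. cmod (ell2_fun (X n) x - ell2_fun (X m) x)) F \<le> norm (X n - X m)"
          using L2_set_le_norm_ell2[OF \<open>finite F\<close>, of "X n - X m"] by (simp add: minus_ell2.rep_eq)
        then show "L2_set (\<lambda>x. cmod (ell2_fun (X n) x - ell2_fun (X m) x)) F \<le> e"
          using N[OF \<open>n \<ge> N\<close> \<open>m \<ge> N\<close>] by (simp add: dist_norm)
      qed
    qed
    then show ?thesis by blast
  qed
  obtain n0 where n0: "\<And>F. finite F \<Longrightarrow> L2_set (\<lambda>x. cmod (ell2_fun (X n0) x - l x)) F \<le> 1"
    using close[of 1] by auto
  have "(\<lambda>x. (cmod (ell2_fun (X n0) x + - (ell2_fun (X n0) x - l x)))\<^sup>2) summable_on UNIV"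
    by (intro ell2_add ell2_summable, subst norm_minus_cancel) (rule ell2_boundI[OF n0])
  then have "(\<lambda>x. (cmod (l x))\<^sup>2) summable_on UNIV"
    by simp
  then obtain L where L: "ell2_fun L = l"
    using Abs_ell2_inverse[of l] by auto
  have "X \<longlonglongrightarrow> L"
  proof (rule LIMSEQ_I)
    fix e :: real assume "0 < e"
    then obtain N where N: "\<forall>n\<ge>N. \<forall>F. finite F \<longrightarrow>
        L2_set (\<lambda>x. cmod (ell2_fun (X n) x - l x)) F \<le> e / 2"
      using close[of "e / 2"] by auto
    have "norm (X n - L) \<le> e / 2" if "n \<ge> N" for n
      using ell2_boundI(2)[of "\<lambda>x. ell2_fun (X n) x - l x" "e / 2"] N that
      by (simp add: norm_ell2.rep_eq minus_ell2.rep_eq L)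
    then show "\<exists>N. \<forall>n\<ge>N. norm (X n - L) < e"
      using \<open>0 < e\<close> by (metis field_sum_of_halves le_less_trans less_add_same_cancel1 half_gt_zero)
  qed
  then show "convergent X"
    by (rule convergentI)
qed

section \<open>The noncommutative disc algebra\<close>

text \<open>With the orthonormal basis \<open>e\<^sub>w = e\<^sub>i\<^sub>1 \<otimes> \<dots> \<otimes> e\<^sub>i\<^sub>k\<close> the full Fock space over an
  \<open>n\<close>-dimensional Hilbert space is the space of square-summable families indexed by words, and
  \<open>S\<^sub>i e\<^sub>w = e\<^sub>i\<^sub>w\<close>.\<close>

type_synonym 'n fock = "'n list ell2"

lemma creation_summable:
  fixes f :: "'n list \<Rightarrow> complex" and i :: 'n
  assumes "(\<lambda>w. (cmod (f w))\<^sup>2) summable_on UNIV"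
  defines "g \<equiv> \<lambda>w. case w of [] \<Rightarrow> 0 | j # v \<Rightarrow> if j = i then f v else 0"
  shows "(\<lambda>w. (cmod (g w))\<^sup>2) summable_on UNIV"
    and "(\<Sum>\<^sub>\<infinity>w. (cmod (g w))\<^sup>2) = (\<Sum>\<^sub>\<infinity>w. (cmod (f w))\<^sup>2)"
proof -
  have inj: "inj (Cons i)"
    by simp
  have zero: "(cmod (g w))\<^sup>2 = 0" if "w \<notin> range (Cons i)" for w
    using that by (auto simp: g_def split: list.splits)
  have comp: "(\<lambda>w. (cmod (g w))\<^sup>2) \<circ> Cons i = (\<lambda>w. (cmod (f w))\<^sup>2)"
    by (auto simp: g_def)
  have "(\<lambda>w. (cmod (g w))\<^sup>2) summable_on UNIV \<longleftrightarrow>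
      (\<lambda>w. (cmod (g w))\<^sup>2) summable_on range (Cons i)"
    by (rule summable_on_cong_neutral) (use zero in auto)
  then show "(\<lambda>w. (cmod (g w))\<^sup>2) summable_on UNIV"
    using assms(1) by (simp add: summable_on_reindex[OF inj] comp)
  have "(\<Sum>\<^sub>\<infinity>w. (cmod (g w))\<^sup>2) = (\<Sum>\<^sub>\<infinity>w\<in>range (Cons i). (cmod (g w))\<^sup>2)"
    by (rule infsum_cong_neutral) (use zero in auto)
  then show "(\<Sum>\<^sub>\<infinity>w. (cmod (g w))\<^sup>2) = (\<Sum>\<^sub>\<infinity>w. (cmod (f w))\<^sup>2)"
    by (simp add: infsum_reindex[OF inj] comp)
qed

lift_definition creation_fun :: "'n \<Rightarrow> 'n fock \<Rightarrow> 'n fock" is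
  "\<lambda>i f w. case w of [] \<Rightarrow> 0 | j # v \<Rightarrow> if j = i then f v else 0"
  by (rule creation_summable)

lemma bounded_linear_creation_fun: "bounded_linear (creation_fun i)"
proof (rule bounded_linear_intro[where K = 1])
  show "creation_fun i (f + g) = creation_fun i f + creation_fun i g" for f g
    by transfer (auto simp: fun_eq_iff split: list.splits)
  show "creation_fun i (r *\<^sub>R f) = r *\<^sub>R creation_fun i f" for r f
    by transfer (auto simp: fun_eq_iff split: list.splits)
  show "norm (creation_fun i f) \<le> norm f * 1" for f
    by transfer (simp add: creation_summable)
qed

lift_definition creation :: "'n \<Rightarrow> 'n fock \<Rightarrow>\<^sub>L 'n fock" is creation_fun
  by (rule bounded_linear_creation_fun)

definition disc_algebra :: "('n fock \<Rightarrow>\<^sub>L 'n fock) set" where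
  "disc_algebra = \<Inter>{\<A>. closed \<A> \<and> id_blinfun \<in> \<A> \<and> range creation \<subseteq> \<A> \<and>
     (\<forall>S\<in>\<A>. \<forall>T\<in>\<A>. S + T \<in> \<A> \<and> S o\<^sub>L T \<in> \<A>) \<and> (\<forall>c. \<forall>T\<in>\<A>. scaleC_op c T \<in> \<A>)}"

definition boundary_in_disc_algebra :: "('n::finite list \<Rightarrow> complex) \<Rightarrow> bool" where
  "boundary_in_disc_algebra a \<longleftrightarrow>
     (\<exists>T\<in>disc_algebra. ((\<lambda>r. fh_eval a (\<lambda>i. r *\<^sub>R creation i)) \<longlongrightarrow> T) (at_left 1))"

end

theory Submission
  imports Defs "HOL-Complex_Analysis.Conformal_Mappings"
begin

text \<open>Let \<open>q\<close> be a test polynomial in \<open>m\<close> variables, and approximate \<open>f\<close> by truncated dilations \<open>g\<close>,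
  which are tuples of polynomials mapping the row ball into itself. Then \<open>q \<circ> g\<close> is a polynomial with
  nonnegative real part. Harnack's inequality on the disc through \<open>g(0)\<close> gives \<open>Re q(g(0)) \<le> c\<close> with
  \<open>c = (1 + \<parallel>f(0)\<parallel>) / (1 - \<parallel>f(0)\<parallel>)\<close>, so \<open>p = (q \<circ> g + c - q(g(0))) / c\<close> is a test polynomial in \<open>n\<close>
  variables, and \<open>q(g(A)) - q(g(B)) = c (p(A) - p(B))\<close>. The limit \<open>g \<rightarrow> f\<close> exists at \<open>A\<close> and \<open>B\<close>
  because the homogeneous parts of \<open>f\<close> decay geometrically at tuples of joint spectral radius less
  than \<open>1\<close>.\<close>

section \<open>Complex inner product spaces\<close>

text \<open>The supremum in \<open>d_K\<close> runs over polynomials only, so \<open>q\<close>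
  composed with \<open>f\<close> itself is not admissible, and partial sums of a contractive series
  need not be contractive; this forces a dilation together with the truncation. The composite
  \<open>q \<circ> g\<close> also misses the normalisation \<open>Re p(0) = I\<close>, since its
  constant term is \<open>q(g(0))\<close>. A constant matrix repairs this and cancels in
  differences, but it preserves positivity only because \<open>c\<close> dominates
  \<open>Re q(g(0))\<close>: this is where \<open>\<parallel>f(0)\<parallel>\<close> enters the
  estimate. One complex variable suffices for that bound because \<open>g(0)\<close> is a tuple of
  scalars: for a fixed vector, the quadratic form of \<open>q\<close> along the complex line through
  0 and \<open>g(0)\<close> is an ordinary holomorphic function. Positivity is tested on the space
  \<open>'k\<close> while \<open>A\<close> and \<open>B\<close> act on \<open>'h\<close>; the two
  spaces share only the coefficients, so composition is carried out on coefficient families and then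
  evaluated on either space.\<close>

lemma scaleC_zero_left [simp]: "0 *\<^sub>C x = (0 :: 'a :: complex_inner)"
  using norm_scaleC[of 0 x] by simp

lemma scaleC_zero_right [simp]: "c *\<^sub>C 0 = (0 :: 'a :: complex_inner)"
  using norm_scaleC[of c 0] by simp

lemma scaleC_one [simp]: "1 *\<^sub>C x = (x :: 'a :: complex_inner)"
  using scaleR_scaleC[of 1 x] by simp

lemma scaleC_sum_left: "(\<Sum>i\<in>I. c i) *\<^sub>C x = (\<Sum>i\<in>I. c i *\<^sub>C (x :: 'a :: complex_inner))"
  by (induction I rule: infinite_finite_induct) (simp_all add: scaleC_add_left)

lemma scaleC_sum_right: "c *\<^sub>C (\<Sum>i\<in>I. x i) = (\<Sum>i\<in>I. c *\<^sub>C (x i :: 'a :: complex_inner))"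
  by (induction I rule: infinite_finite_induct) (simp_all add: scaleC_add_right)

lemma minus_scaleC: "- x = (-1) *\<^sub>C (x :: 'a :: complex_inner)"
  using scaleR_scaleC[of "-1" x] by simp

lemma cinner_add_right: "cinner x (y + z) = cinner x y + cinner x (z :: 'a :: complex_inner)"
  by (metis cinner_add_left cinner_commute complex_cnj_add)

lemma cinner_scaleC_right: "cinner x (c *\<^sub>C y) = cnj c * cinner x (y :: 'a :: complex_inner)"
  by (metis cinner_scaleC_left cinner_commute complex_cnj_mult)

lemma cinner_zero_left [simp]: "cinner 0 (x :: 'a :: complex_inner) = 0"
  using cinner_scaleC_left[of 0 0 x] by simp

lemma cinner_zero_right [simp]: "cinner (x :: 'a :: complex_inner) 0 = 0"
  using cinner_scaleC_right[of x 0 0] by simp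

lemma cinner_minus_left: "cinner (- x) y = - cinner x (y :: 'a :: complex_inner)"
  by (simp add: minus_scaleC[of x] cinner_scaleC_left)

lemma cinner_minus_right: "cinner x (- y) = - cinner x (y :: 'a :: complex_inner)"
  by (simp add: minus_scaleC[of y] cinner_scaleC_right)

lemma cinner_diff_left: "cinner (x - y) z = cinner x z - cinner y (z :: 'a :: complex_inner)"
  unfolding diff_conv_add_uminus cinner_add_left cinner_minus_left ..

lemma cinner_diff_right: "cinner x (y - z) = cinner x y - cinner x (z :: 'a :: complex_inner)"
  unfolding diff_conv_add_uminus cinner_add_right cinner_minus_right ..

lemma cinner_scaleR_left: "cinner (r *\<^sub>R x) y = of_real r * cinner x (y :: 'a :: complex_inner)"
  by (simp add: scaleR_scaleC cinner_scaleC_left)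

lemma cinner_scaleR_right: "cinner x (r *\<^sub>R y) = of_real r * cinner x (y :: 'a :: complex_inner)"
  by (simp add: scaleR_scaleC cinner_scaleC_right)

lemma cinner_sum_left: "cinner (\<Sum>i\<in>I. x i) y = (\<Sum>i\<in>I. cinner (x i) (y :: 'a :: complex_inner))"
  by (induction I rule: infinite_finite_induct) (simp_all add: cinner_add_left)

lemma Re_cinner_commute: "Re (cinner x y) = Re (cinner y (x :: 'a :: complex_inner))"
  by (subst cinner_commute) simp

lemma norm_add_cinner:
  "(norm (x + y :: 'a :: complex_inner))\<^sup>2 = (norm x)\<^sup>2 + (norm y)\<^sup>2 + 2 * Re (cinner x y)"
proof -
  have "(norm (x + y))\<^sup>2 = Re (cinner (x + y) (x + y))"
    by (simp add: cinner_self)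
  also have "\<dots> = (norm x)\<^sup>2 + (norm y)\<^sup>2 + 2 * Re (cinner x y)"
    unfolding cinner_add_left cinner_add_right by (simp add: cinner_self Re_cinner_commute[of y x])
  finally show ?thesis .
qed

lemma norm_diff_cinner:
  "(norm (x - y :: 'a :: complex_inner))\<^sup>2 = (norm x)\<^sup>2 + (norm y)\<^sup>2 - 2 * Re (cinner x y)"
  using norm_add_cinner[of x "- y"] by (simp add: cinner_minus_right)

lemma cinner_Cauchy_Schwarz: "cmod (cinner x y) \<le> norm x * norm (y :: 'a :: complex_inner)"
proof (cases "y = 0")
  case False
  \<comment> \<open>The vector \<open>s x - c y\<close> used below is
    \<open>(norm y)\<^sup>2\<close> times the component of \<open>x\<close> orthogonal to
    \<open>y\<close>; this scaling avoids a division, and the claim is that its squared norm is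
    nonnegative.\<close>
  define c where "c = cinner x y"
  define s where "s = (norm y)\<^sup>2"
  have "0 < s"
    using False by (simp add: s_def)
  have "cinner (of_real s *\<^sub>C x) (c *\<^sub>C y) = of_real s * (c * cnj c)"
    by (simp add: cinner_scaleC_left cinner_scaleC_right c_def mult.commute)
  also have "\<dots> = of_real (s * (cmod c)\<^sup>2)"
    by (simp only: complex_norm_square of_real_mult)
  finally have "Re (cinner (of_real s *\<^sub>C x) (c *\<^sub>C y)) = s * (cmod c)\<^sup>2"
    by (simp only: Re_complex_of_real)
  then have "(norm (of_real s *\<^sub>C x - c *\<^sub>C y))\<^sup>2 = s * (s * (norm x)\<^sup>2 - (cmod c)\<^sup>2)"
    using \<open>0 < s\<close> by (simp add: norm_diff_cinner norm_scaleC power_mult_distrib s_def[symmetric])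
      (simp add: power2_eq_square algebra_simps)
  then have "0 \<le> s * (s * (norm x)\<^sup>2 - (cmod c)\<^sup>2)"
    by (metis zero_le_power2)
  then have "(cmod c)\<^sup>2 \<le> (norm x * norm y)\<^sup>2"
    using \<open>0 < s\<close> by (simp add: zero_le_mult_iff power_mult_distrib mult.commute s_def)
  then show ?thesis
    unfolding c_def by (rule power2_le_imp_le) simp
qed simp

lemma cinner_eq_imp_eq:
  assumes "\<And>x. cinner x y = cinner x (z :: 'a :: complex_inner)"
  shows "y = z"
proof -
  have "cinner (y - z) (y - z) = 0"
    using assms by (simp add: cinner_diff_right)
  then show ?thesis
    by (simp add: cinner_self)
qed

section \<open>Riesz representation and adjoints\<close>

text \<open>The representing vector minimises \<open>\<parallel>y\<parallel>\<^sup>2 - 2 Re (l y)\<close>; a minimising sequence is Cauchy by the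
  parallelogram identity.\<close>

lemma Riesz_representation:
  fixes l :: "'a :: chilbert_space \<Rightarrow> complex"
  assumes add: "\<And>x y. l (x + y) = l x + l y"
    and scale: "\<And>c x. l (c *\<^sub>C x) = c * l x"
    and bound: "\<And>x. cmod (l x) \<le> K * norm x"
  obtains m where "\<And>x. l x = cinner x m"
proof -
  define J where "J y = (norm y)\<^sup>2 - 2 * Re (l y)" for y
  have scaleR: "l (r *\<^sub>R x) = of_real r * l x" for r x
    by (simp add: scaleR_scaleC scale)
  have bl: "bounded_linear l"
    by (rule bounded_linear_intro[where K = K])
      (simp_all add: add scaleR bound mult.commute scaleR_conv_of_real)
  have J_lower: "- K\<^sup>2 \<le> J y" for y
  proof -
    have "Re (l y) \<le> K * norm y"
      using complex_Re_le_cmod[of "l y"] bound[of y] by linarith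
    then have "0 \<le> J y + K\<^sup>2 - (norm y - K)\<^sup>2"
      by (simp add: J_def power2_eq_square algebra_simps)
    then show ?thesis
      using zero_le_power2[of "norm y - K"] by linarith
  qed
  define d where "d = Inf (range J)"
  have bdd: "bdd_below (range J)"
    using J_lower by (intro bdd_belowI[where m = "- K\<^sup>2"]) auto
  have d_le: "d \<le> J y" for y
    unfolding d_def by (rule cInf_lower[OF _ bdd]) simp
  have "\<exists>y. J y < d + 1 / real (Suc n)" for n
    using cInf_lessD[of "range J" "d + 1 / real (Suc n)"] by (auto simp: d_def)
  then obtain Y where Y: "\<And>n. J (Y n) < d + 1 / real (Suc n)"
    by metis
  have near: "(norm (Y n - Y k))\<^sup>2 \<le> 2 / real (Suc n) + 2 / real (Suc k)" for n k
  proof -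
    have "(norm (Y n - Y k))\<^sup>2 =
        2 * J (Y n) + 2 * J (Y k) - 4 * J ((1/2) *\<^sub>R (Y n + Y k))"
      by (simp add: J_def norm_diff_cinner norm_add_cinner scaleR add power_mult_distrib
          cinner_scaleR_left cinner_scaleR_right Re_cinner_commute[of "Y k" "Y n"]
          power2_eq_square[of "1/2::real"] field_simps)
    moreover have "2 * J (Y n) \<le> 2 * d + 2 / real (Suc n)" "2 * J (Y k) \<le> 2 * d + 2 / real (Suc k)"
      using Y[of n] Y[of k] by simp_all
    ultimately show ?thesis
      using d_le[of "(1/2) *\<^sub>R (Y n + Y k)"] by linarith
  qed
  have "Cauchy Y"
  proof (rule CauchyI)
    fix e :: real assume e: "0 < e"
    obtain N where N: "4 / e\<^sup>2 < real N"
      using reals_Archimedean2 by blast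
    have "norm (Y n - Y k) < e" if "n \<ge> N" "k \<ge> N" for n k
    proof -
      have Npos: "0 < real N"
        using N e by (smt (verit) divide_pos_pos zero_less_power)
      have inv: "2 / real (Suc i) < 2 / real N" if "i \<ge> N" for i
        using that Npos by (intro divide_strict_left_mono) auto
      have "(norm (Y n - Y k))\<^sup>2 < 4 / real N"
        using near[of n k] inv[OF that(1)] inv[OF that(2)] by linarith
      also have "\<dots> < e\<^sup>2"
        using N e Npos by (simp add: field_simps)
      finally show ?thesis
        using e by (simp add: power_less_imp_less_base)
    qed
    then show "\<exists>M. \<forall>m\<ge>M. \<forall>n\<ge>M. norm (Y m - Y n) < e"
      by blast
  qed
  then obtain m where m: "Y \<longlonglongrightarrow> m"
    using Cauchy_convergent convergentD by blast
  have J_lim: "(\<lambda>n. J (Y n)) \<longlonglongrightarrow> J m"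
    unfolding J_def by (intro tendsto_intros m bounded_linear.tendsto[OF bl])
  have d_lim: "(\<lambda>n. d + 1 / real (Suc n)) \<longlonglongrightarrow> d + 0"
    by (intro tendsto_intros LIMSEQ_inverse_real_of_nat[unfolded inverse_eq_divide])
  have "\<exists>N. \<forall>n\<ge>N. J (Y n) \<le> d + 1 / real (Suc n)"
    using Y less_imp_le by blast
  from LIMSEQ_le[OF J_lim d_lim this] have "J m \<le> d"
    by simp
  \<comment> \<open>First-order condition at the minimiser: a real quadratic in \<open>t\<close>
    without constant term that is never negative has no linear term.\<close>
  have Re_eq: "Re (l h) = Re (cinner h m)" for h
  proof -
    define b where "b = 2 * (Re (cinner h m) - Re (l h))"
    have pos: "0 \<le> t\<^sup>2 * (norm h)\<^sup>2 + t * b" for t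
    proof -
      have "J (m + t *\<^sub>R h) - J m = t\<^sup>2 * (norm h)\<^sup>2 + t * b"
        by (simp add: J_def b_def norm_add_cinner add scaleR cinner_scaleR_right
            power_mult_distrib algebra_simps Re_cinner_commute[of m h])
      then show ?thesis
        using \<open>J m \<le> d\<close> d_le[of "m + t *\<^sub>R h"] by linarith
    qed
    have "b = 0"
    proof (rule ccontr)
      assume "b \<noteq> 0"
      \<comment> \<open>The quadratic is tested at \<open>t = - b / H\<close>; the added 1 keeps the
        denominator positive when \<open>h = 0\<close>.\<close>
      define H where "H = (norm h)\<^sup>2 + 1"
      have "0 < H"
        by (simp add: H_def add_nonneg_pos)
      have "0 < (b / H)\<^sup>2"
        using \<open>b \<noteq> 0\<close> \<open>0 < H\<close> by simp
      have "0 \<le> (b / H)\<^sup>2 * (norm h)\<^sup>2 - b\<^sup>2 / H"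
        using pos[of "- b / H"] by (simp add: power2_eq_square)
      also have "\<dots> = (b / H)\<^sup>2 * (H - 1) - (b / H)\<^sup>2 * H"
        using \<open>0 < H\<close> by (simp add: H_def power2_eq_square)
      also have "\<dots> = - ((b / H)\<^sup>2)"
        by (simp add: algebra_simps)
      finally show False
        using \<open>0 < (b / H)\<^sup>2\<close> by simp
    qed
    then show ?thesis
      by (simp add: b_def)
  qed
  have "l x = cinner x m" for x
  proof (rule complex_eqI[OF Re_eq])
    \<comment> \<open>Multiplication by \<open>- \<i>\<close> turns an imaginary part into a real
      part, and both sides are complex linear in \<open>x\<close>.\<close>
    show "Im (l x) = Im (cinner x m)"
      using Re_eq[of "(- \<i>) *\<^sub>C x"] by (simp add: scale cinner_scaleC_left)
  qed
  then show thesis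
    by (rule that)
qed

lemma bounded_opsI: "(\<And>c x. blinfun_apply T (c *\<^sub>C x) = c *\<^sub>C T x) \<Longrightarrow> T \<in> bounded_ops"
  by (simp add: bounded_ops_def)

lemma bounded_opsD: "T \<in> bounded_ops \<Longrightarrow> blinfun_apply T (c *\<^sub>C x) = c *\<^sub>C T x"
  by (simp add: bounded_ops_def)

text \<open>\<open>adj\<close> is a definite description, so every later fact about it rests on
  this. Riesz supplies the value at each \<open>y\<close>; the identity \<open>\<parallel>S
  y\<parallel>\<^sup>2 = \<langle>T (S y), y\<rangle>\<close> bounds the resulting map. Complex
  linearity is essential: a merely real-linear \<open>T\<close> has no adjoint for the complex inner
  product.\<close>

lemma ex_adjoint:
  fixes T :: "'a::chilbert_space \<Rightarrow>\<^sub>L 'b::chilbert_space"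
  assumes T: "T \<in> bounded_ops"
  shows "\<exists>!S :: 'b \<Rightarrow>\<^sub>L 'a. \<forall>x y. cinner (T x) y = cinner x (blinfun_apply S y)"
proof -
  have "\<exists>m. \<forall>x. cinner (T x) y = cinner x m" for y
  proof (rule Riesz_representation[where l = "\<lambda>x. cinner (T x) y" and K = "norm T * norm y"])
    show "cmod (cinner (T x) y) \<le> norm T * norm y * norm x" for x
      using order_trans[OF cinner_Cauchy_Schwarz mult_right_mono[OF norm_blinfun norm_ge_zero]]
      by (simp add: mult_ac)
  qed (auto simp: blinfun.add_right cinner_add_left bounded_opsD[OF T] cinner_scaleC_left)
  then obtain S where S: "\<And>x y. cinner (T x) y = cinner x (S y)"
    by metis
  have "bounded_linear S"
  proof (rule bounded_linear_intro[where K = "norm T"])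
    show "S (y + z) = S y + S z" for y z
      by (rule cinner_eq_imp_eq) (simp add: cinner_add_right flip: S)
    show "S (r *\<^sub>R y) = r *\<^sub>R S y" for r y
      by (rule cinner_eq_imp_eq) (simp add: cinner_scaleR_right flip: S)
    show "norm (S y) \<le> norm y * norm T" for y
    proof -
      have "norm (S y) * norm (S y) = cmod (cinner (T (S y)) y)"
          by (simp add: S cinner_self norm_mult power2_eq_square)
      also have "\<dots> \<le> (norm T * norm (S y)) * norm y"
        using order_trans[OF cinner_Cauchy_Schwarz mult_right_mono[OF norm_blinfun norm_ge_zero]] .
      finally show ?thesis
        by (cases "S y = 0") (simp_all add: mult_ac)
    qed
  qed
  then have S': "\<forall>x y. cinner (T x) y = cinner x (Blinfun S y)"
    by (simp add: S bounded_linear_Blinfun_apply)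
  show ?thesis
  proof (rule ex1I[of _ "Blinfun S"])
    show "\<forall>x y. cinner (T x) y = cinner x (Blinfun S y)"
      by (rule S')
  next
    fix R assume "\<forall>x y. cinner (T x) y = cinner x (blinfun_apply R y)"
    then show "R = Blinfun S"
      using S' by (intro blinfun_eqI cinner_eq_imp_eq) simp
  qed
qed

lemma cinner_adj_right:
  assumes "T \<in> bounded_ops"
  shows "cinner x (adj T y) = cinner (T x) y"
  unfolding adj_def by (rule theI'[OF ex_adjoint[OF assms], rule_format, symmetric])

lemma cinner_adj_left:
  assumes "T \<in> bounded_ops"
  shows "cinner (adj T y) x = cinner y (T x)"
  using cinner_adj_right[OF assms, of x y] cinner_commute[of "adj T y" x] cinner_commute[of y "T x"]
  by (simp only:)

lemma adj_eqI:
  assumes "T \<in> bounded_ops" "\<And>x y. cinner (T x) y = cinner x (blinfun_apply S y)"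
  shows "adj T = S"
  unfolding adj_def by (rule the1_equality[OF ex_adjoint]) (use assms in auto)

lemma norm_adj_le:
  assumes T: "T \<in> bounded_ops"
  shows "norm (adj T) \<le> norm T"
proof (rule norm_blinfun_bound)
  show "norm (adj T y) \<le> norm T * norm y" for y
  proof -
    have "norm (adj T y) * norm (adj T y) = cmod (cinner (T (adj T y)) y)"
      by (simp add: cinner_self norm_mult power2_eq_square flip: cinner_adj_right[OF T])
    also have "\<dots> \<le> (norm T * norm (adj T y)) * norm y"
      using order_trans[OF cinner_Cauchy_Schwarz mult_right_mono[OF norm_blinfun norm_ge_zero]] .
    finally show ?thesis
      by (cases "adj T y = 0") (simp_all add: mult_ac)
  qed
qed simp

section \<open>Complex multiples of operators and the algebra of complex-linear operators\<close>

lemma scaleC_op_apply [simp]: "scaleC_op c T x = c *\<^sub>C T x"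
  by (simp add: scaleC_op.rep_eq)

lemma scaleC_op_zero_left [simp]: "scaleC_op 0 T = 0"
  by (rule blinfun_eqI) simp

lemma scaleC_op_one [simp]: "scaleC_op 1 T = T"
  by (rule blinfun_eqI) simp

lemma scaleC_op_zero_right [simp]: "scaleC_op c 0 = 0"
  by (rule blinfun_eqI) simp

lemma scaleC_op_scaleC_op [simp]: "scaleC_op c (scaleC_op d T) = scaleC_op (c * d) T"
  by (rule blinfun_eqI) (simp add: scaleC_scaleC)

lemma scaleC_op_add_left: "scaleC_op (c + d) T = scaleC_op c T + scaleC_op d T"
  by (rule blinfun_eqI) (simp add: scaleC_add_left blinfun.add_left)

lemma scaleC_op_diff_left: "scaleC_op (c - d) T = scaleC_op c T - scaleC_op d T"
  by (metis add_diff_cancel_right' diff_add_cancel scaleC_op_add_left)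

lemma scaleC_op_sum_left: "scaleC_op (\<Sum>i\<in>I. c i) T = (\<Sum>i\<in>I. scaleC_op (c i) T)"
  by (rule blinfun_eqI) (simp add: scaleC_sum_left blinfun.sum_left)

lemma scaleC_op_sum_right: "scaleC_op c (\<Sum>i\<in>I. T i) = (\<Sum>i\<in>I. scaleC_op c (T i))"
  by (rule blinfun_eqI) (simp add: scaleC_sum_right blinfun.sum_left)

lemma scaleC_op_add_right: "scaleC_op c (S + T) = scaleC_op c S + scaleC_op c T"
  by (rule blinfun_eqI) (simp add: scaleC_add_right blinfun.add_left)

lemma scaleC_op_diff_right: "scaleC_op c (S - T) = scaleC_op c S - scaleC_op c T"
  by (metis add_diff_cancel_right' diff_add_cancel scaleC_op_add_right)

lemma scaleR_eq_scaleC_op: "r *\<^sub>R T = scaleC_op (of_real r) T"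
  by (rule blinfun_eqI) (simp add: scaleR_scaleC blinfun.scaleR_left)

lemma scaleC_op_comp_left: "scaleC_op c S o\<^sub>L T = scaleC_op c (S o\<^sub>L T)"
  by (rule blinfun_eqI) simp

lemma scaleC_op_comp_right: "S \<in> bounded_ops \<Longrightarrow> S o\<^sub>L scaleC_op c T = scaleC_op c (S o\<^sub>L T)"
  by (rule blinfun_eqI) (simp add: bounded_opsD)

lemma norm_scaleC_op_le: "norm (scaleC_op c T) \<le> cmod c * norm T"
  by (rule norm_blinfun_bound)
    (simp_all add: norm_scaleC mult.assoc mult_left_mono norm_blinfun)

lemma bounded_linear_scaleC_op: "bounded_linear (scaleC_op c)"
  by (rule bounded_linear_intro[where K = "cmod c"])
    (auto simp: scaleC_op_add_right scaleR_eq_scaleC_op mult.commute intro: norm_scaleC_op_le[THEN order_trans])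

lemma bounded_ops_zero [simp]: "0 \<in> bounded_ops"
  by (rule bounded_opsI) simp

lemma bounded_ops_id [simp]: "id_blinfun \<in> bounded_ops"
  by (rule bounded_opsI) simp

lemma bounded_ops_add: "S \<in> bounded_ops \<Longrightarrow> T \<in> bounded_ops \<Longrightarrow> S + T \<in> bounded_ops"
  by (rule bounded_opsI) (simp add: blinfun.add_left bounded_opsD scaleC_add_right)

lemma bounded_ops_scaleC: "T \<in> bounded_ops \<Longrightarrow> scaleC_op c T \<in> bounded_ops"
  by (rule bounded_opsI) (simp add: bounded_opsD scaleC_scaleC mult.commute)

lemma bounded_ops_scaleR: "T \<in> bounded_ops \<Longrightarrow> r *\<^sub>R T \<in> bounded_ops"
  by (simp add: scaleR_eq_scaleC_op bounded_ops_scaleC)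

lemma bounded_ops_diff:
  assumes "S \<in> bounded_ops" "T \<in> bounded_ops"
  shows "S - T \<in> bounded_ops"
  using bounded_ops_add[OF assms(1) bounded_ops_scaleR[OF assms(2), of "-1"]] by simp

lemma bounded_ops_comp: "S \<in> bounded_ops \<Longrightarrow> T \<in> bounded_ops \<Longrightarrow> S o\<^sub>L T \<in> bounded_ops"
  by (rule bounded_opsI) (simp add: bounded_opsD)

lemma bounded_ops_sum: "(\<And>i. i \<in> I \<Longrightarrow> T i \<in> bounded_ops) \<Longrightarrow> (\<Sum>i\<in>I. T i) \<in> bounded_ops"
  by (induction I rule: infinite_finite_induct) (simp_all add: bounded_ops_add)

lemma bounded_ops_op_word: "(\<And>i. X i \<in> bounded_ops) \<Longrightarrow> op_word X w \<in> bounded_ops"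
  by (induction w) (simp_all add: bounded_ops_comp)

lemma tendsto_blinfun_apply: "(T \<longlongrightarrow> S) F \<Longrightarrow> ((\<lambda>n. blinfun_apply (T n) x) \<longlongrightarrow> blinfun_apply S x) F"
  by (rule bounded_linear.tendsto[OF blinfun.bounded_linear_left])

text \<open>Ensures that \<open>ex_adjoint\<close> still applies to a norm limit, as
  \<open>tendsto_adj\<close> requires.\<close>

lemma closed_bounded_ops: "closed (bounded_ops :: ('a::complex_inner \<Rightarrow>\<^sub>L 'b::complex_inner) set)"
  unfolding closed_sequential_limits
proof (intro allI impI, elim conjE)
  fix T :: "nat \<Rightarrow> 'a \<Rightarrow>\<^sub>L 'b" and S
  assume T: "\<forall>n. T n \<in> bounded_ops" and lim: "T \<longlonglongrightarrow> S"
  show "S \<in> bounded_ops"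
  proof (rule bounded_opsI)
    fix c x
    have "(\<lambda>n. T n (c *\<^sub>C x)) \<longlonglongrightarrow> c *\<^sub>C S x"
      using T by (simp add: bounded_opsD bounded_linear.tendsto[OF bounded_linear_scaleC]
          tendsto_blinfun_apply[OF lim])
    then show "S (c *\<^sub>C x) = c *\<^sub>C S x"
      using tendsto_blinfun_apply[OF lim] LIMSEQ_unique by blast
  qed
qed

lemma adj_scaleC: "T \<in> bounded_ops \<Longrightarrow> adj (scaleC_op c T) = scaleC_op (cnj c) (adj T)"
  by (rule adj_eqI)
    (simp_all add: bounded_ops_scaleC cinner_scaleC_left cinner_scaleC_right cinner_adj_right)

lemma adj_diff:
  "S \<in> bounded_ops \<Longrightarrow> T \<in> bounded_ops \<Longrightarrow> adj (S - T) = adj S - adj T"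
  by (rule adj_eqI)
    (simp_all add: bounded_ops_diff blinfun.diff_left cinner_diff_left cinner_diff_right cinner_adj_right)

lemma adj_id [simp]: "adj id_blinfun = id_blinfun"
  by (rule adj_eqI) simp_all

lemma adj_zero [simp]: "adj 0 = 0"
  by (rule adj_eqI) simp_all

lemma tendsto_adj:
  assumes "\<And>n. T n \<in> bounded_ops" "T \<longlonglongrightarrow> S"
  shows "(\<lambda>n. adj (T n)) \<longlonglongrightarrow> adj S"
proof -
  have S: "S \<in> bounded_ops"
    using closed_sequentially[OF closed_bounded_ops] assms by blast
  have "(\<lambda>n. norm (adj (T n) - adj S)) \<longlonglongrightarrow> 0"
  proof (rule tendsto_sandwich[OF _ _ tendsto_const])
    show "(\<lambda>n. norm (T n - S)) \<longlonglongrightarrow> 0"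
      using assms(2) by (simp add: LIM_zero tendsto_norm_zero)
    show "\<forall>\<^sub>F n in sequentially. norm (adj (T n) - adj S) \<le> norm (T n - S)"
      using norm_adj_le[OF bounded_ops_diff[OF assms(1) S]] by (simp add: adj_diff assms(1) S)
  qed simp
  then show ?thesis
    by (simp add: LIM_zero_iff tendsto_norm_zero_iff)
qed

section \<open>Row operators and words\<close>

lemma sum_norm_adj:
  assumes "\<And>i. i \<in> I \<Longrightarrow> T i \<in> bounded_ops"
  shows "(\<Sum>i\<in>I. (norm (adj (T i) y))\<^sup>2) = Re (cinner ((\<Sum>i\<in>I. T i o\<^sub>L adj (T i)) y) y)"
proof -
  have "(norm (adj (T i) y))\<^sup>2 = Re (cinner (T i (adj (T i) y)) y)" if "i \<in> I" for i
    using arg_cong[OF cinner_adj_right[OF assms[OF that], of "adj (T i) y" y], of Re]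
    by (simp add: cinner_self)
  then show ?thesis
    by (simp add: blinfun.sum_left cinner_sum_left)
qed

lemma sum_norm_adj_le:
  assumes "\<And>i. i \<in> I \<Longrightarrow> T i \<in> bounded_ops"
  shows "(\<Sum>i\<in>I. (norm (adj (T i) y))\<^sup>2) \<le> norm ((\<Sum>i\<in>I. T i o\<^sub>L adj (T i)) y) * norm y"
  using order_trans[OF complex_Re_le_cmod cinner_Cauchy_Schwarz] by (simp only: sum_norm_adj assms)

text \<open>One half of the identity \<open>\<parallel>T\<parallel>\<^sup>2 = \<parallel>T
  T\<^sup>*\<parallel>\<close> for the row \<open>T\<close> of the \<open>T i\<close>, obtained
  without forming a direct sum: for \<open>y = T x\<close>, write
  \<open>\<parallel>y\<parallel>\<^sup>2\<close> as the pairing of \<open>x\<close> with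
  \<open>T\<^sup>* y\<close> and bound \<open>\<parallel>T\<^sup>* y\<parallel>\<^sup>2 = \<langle>T
  T\<^sup>* y, y\<rangle>\<close>.\<close>

lemma row_operator_bound:
  assumes T: "\<And>i. i \<in> I \<Longrightarrow> T i \<in> bounded_ops"
  shows "(norm (\<Sum>i\<in>I. T i (x i)))\<^sup>2
           \<le> norm (\<Sum>i\<in>I. T i o\<^sub>L adj (T i)) * (\<Sum>i\<in>I. (norm (x i))\<^sup>2)"
proof -
  define y where "y = (\<Sum>i\<in>I. T i (x i))"
  define G where "G = (\<Sum>i\<in>I. T i o\<^sub>L adj (T i))"
  define L where "L = L2_set (\<lambda>i. norm (x i)) I"
  have "0 \<le> L"
    by (simp add: L_def)
  have "L2_set (\<lambda>i. norm (adj (T i) y)) I \<le> sqrt (norm G) * norm y"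
  proof -
    have "(\<Sum>i\<in>I. (norm (adj (T i) y))\<^sup>2) \<le> norm (G y) * norm y"
      unfolding G_def by (rule sum_norm_adj_le[OF T])
    also have "\<dots> \<le> norm G * norm y * norm y"
      by (intro mult_right_mono norm_blinfun) simp
    also have "\<dots> = (sqrt (norm G) * norm y)\<^sup>2"
      by (simp add: power_mult_distrib power2_eq_square mult.assoc)
    finally show ?thesis
      by (simp add: L2_set_def real_le_lsqrt)
  qed
  have "norm y * norm y = Re (\<Sum>i\<in>I. cinner (x i) (adj (T i) y))"
  proof -
    have "norm y * norm y = Re (cinner y y)"
      by (simp add: cinner_self power2_eq_square)
    also have "cinner y y = (\<Sum>i\<in>I. cinner (T i (x i)) y)"
      by (subst (1) y_def) (simp add: cinner_sum_left)
    also have "\<dots> = (\<Sum>i\<in>I. cinner (x i) (adj (T i) y))"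
      by (intro sum.cong refl) (simp add: cinner_adj_right T)
    finally show ?thesis .
  qed
  also have "\<dots> \<le> (\<Sum>i\<in>I. \<bar>norm (x i)\<bar> * \<bar>norm (adj (T i) y)\<bar>)"
    unfolding Re_sum
    by (intro sum_mono order_trans[OF complex_Re_le_cmod order_trans[OF cinner_Cauchy_Schwarz]]) simp
  also have "\<dots> \<le> L * L2_set (\<lambda>i. norm (adj (T i) y)) I"
    unfolding L_def by (rule L2_set_mult_ineq)
  also have "\<dots> \<le> L * (sqrt (norm G) * norm y)"
    using \<open>0 \<le> L\<close> \<open>L2_set (\<lambda>i. norm (adj (T i) y)) I \<le> _\<close> by (rule mult_left_mono[rotated])
  finally have "norm y \<le> L * sqrt (norm G)"
    using \<open>0 \<le> L\<close> by (cases "y = 0") (simp_all add: mult.assoc[symmetric])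
  then have "(norm y)\<^sup>2 \<le> (L * sqrt (norm G))\<^sup>2"
    by (rule power_mono) simp
  then show ?thesis
    by (simp add: y_def G_def L_def L2_set_def power_mult_distrib sum_nonneg mult.commute)
qed

text \<open>The other half: feeding the column \<open>T\<^sup>* y\<close> into the row bound gives
  \<open>\<parallel>G y\<parallel>\<^sup>2 \<le> C \<parallel>G y\<parallel>
  \<parallel>y\<parallel>\<close> for \<open>G = T T\<^sup>*\<close>.\<close>

lemma row_operator_bound_converse:
  assumes T: "\<And>i. i \<in> I \<Longrightarrow> T i \<in> bounded_ops"
    and le: "\<And>x. (norm (\<Sum>i\<in>I. T i (x i)))\<^sup>2 \<le> C * (\<Sum>i\<in>I. (norm (x i))\<^sup>2)"
    and C: "0 \<le> C"
  shows "norm (\<Sum>i\<in>I. T i o\<^sub>L adj (T i)) \<le> C"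
proof (rule norm_blinfun_bound[OF C])
  fix y
  define G where "G = (\<Sum>i\<in>I. T i o\<^sub>L adj (T i))"
  have "(norm (G y))\<^sup>2 \<le> C * (\<Sum>i\<in>I. (norm (adj (T i) y))\<^sup>2)"
    using le[of "\<lambda>i. adj (T i) y"] by (simp add: G_def blinfun.sum_left)
  also have "\<dots> \<le> C * (norm (G y) * norm y)"
    unfolding G_def by (intro mult_left_mono sum_norm_adj_le T C)
  finally show "norm (G y) \<le> C * norm y"
    using C by (cases "G y = 0") (simp_all add: power2_eq_square mult.left_commute[of C])
qed

section \<open>Rows formed by all words of a given length\<close>

lemma sum_words_append:
  "(\<Sum>w :: 'n::finite list | length w = k + l. f w)
     = (\<Sum>u | length u = k. \<Sum>v | length v = l. f (u @ v))"
  unfolding sum.cartesian_product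
  by (rule sum.reindex_bij_witness[of _ "\<lambda>(u, v). u @ v" "\<lambda>w. (take k w, drop k w)"]) auto

lemma op_word_append: "op_word X (u @ v) = op_word X u o\<^sub>L op_word X v"
  by (induction u) (auto simp: blinfun_eqI)

lemma op_word_scaleR: "op_word (\<lambda>i. r *\<^sub>R X i) w = r ^ length w *\<^sub>R op_word X w"
  by (induction w) (auto intro!: blinfun_eqI simp: blinfun.scaleR_left blinfun.scaleR_right)

text \<open>By the two row bounds this is the squared norm of the row of all
  \<open>op_word X w\<close> with \<open>length w = k\<close>; its roots of order
  \<open>2 * k\<close> define the joint spectral radius.\<close>

definition level_norm :: "('n::finite \<Rightarrow> 'a::chilbert_space \<Rightarrow>\<^sub>L 'a) \<Rightarrow> nat \<Rightarrow> real" where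
  "level_norm X k = norm (\<Sum>w | length w = k. op_word X w o\<^sub>L adj (op_word X w))"

lemma level_norm_nonneg [simp]: "0 \<le> level_norm X k"
  by (simp add: level_norm_def)

lemma level_norm_bound:
  assumes "\<And>i. X i \<in> bounded_ops"
  shows "(norm (\<Sum>w | length w = k. op_word X w (x w)))\<^sup>2
           \<le> level_norm X k * (\<Sum>w | length w = k. (norm (x w))\<^sup>2)"
  unfolding level_norm_def by (rule row_operator_bound) (rule bounded_ops_op_word[OF assms])

text \<open>Words of length \<open>k + l\<close> split uniquely, so their row is the row of level
  \<open>k\<close> applied to a block diagonal of rows of level \<open>l\<close>.\<close>

lemma level_norm_add_le:
  assumes X: "\<And>i. X i \<in> bounded_ops"
  shows "level_norm X (k + l) \<le> level_norm X k * level_norm X l"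
  unfolding level_norm_def[of X "k + l"]
proof (rule row_operator_bound_converse)
  fix x
  have "(norm (\<Sum>w | length w = k + l. op_word X w (x w)))\<^sup>2
      = (norm (\<Sum>u | length u = k. op_word X u (\<Sum>v | length v = l. op_word X v (x (u @ v)))))\<^sup>2"
    by (simp add: sum_words_append op_word_append blinfun.sum_right)
  also have "\<dots> \<le> level_norm X k *
      (\<Sum>u | length u = k. (norm (\<Sum>v | length v = l. op_word X v (x (u @ v))))\<^sup>2)"
    by (rule level_norm_bound[OF X])
  also have "\<dots> \<le> level_norm X k *
      (\<Sum>u | length u = k. level_norm X l * (\<Sum>v | length v = l. (norm (x (u @ v)))\<^sup>2))"
    by (intro mult_left_mono sum_mono level_norm_bound[OF X]) simp
  finally show "(norm (\<Sum>w | length w = k + l. op_word X w (x w)))\<^sup>2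
      \<le> level_norm X k * level_norm X l * (\<Sum>w | length w = k + l. (norm (x w))\<^sup>2)"
    by (simp add: sum_words_append sum_distrib_left mult.assoc)
qed (auto intro: bounded_ops_op_word[OF X])

text \<open>Not an equation, because the identity of the zero space has norm 0.\<close>

lemma level_norm_0_le: "level_norm X 0 \<le> 1"
  by (auto simp: level_norm_def intro!: norm_blinfun_bound)

lemma level_norm_1: "level_norm X 1 = norm (\<Sum>i\<in>UNIV. X i o\<^sub>L adj (X i))"
proof -
  have "(\<Sum>w | length w = 1. op_word X w o\<^sub>L adj (op_word X w)) = (\<Sum>i\<in>UNIV. X i o\<^sub>L adj (X i))"
  proof (rule sum.reindex_bij_witness[of _ "\<lambda>i. [i]" hd])
    fix w :: "'a list" assume "w \<in> {w. length w = 1}"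
    then obtain i where w: "w = [i]"
      by (auto simp: length_Suc_conv)
    have "X i o\<^sub>L id_blinfun = X i"
      by (rule blinfun_eqI) simp
    then show "X (hd w) o\<^sub>L adj (X (hd w)) = op_word X w o\<^sub>L adj (op_word X w)" "[hd w] = w"
      by (simp_all add: w)
  qed auto
  then show ?thesis
    by (simp add: level_norm_def)
qed

text \<open>The bound is uniform over the ball, which is why one truncation degree will serve all of
  its points.\<close>

lemma level_norm_row_ball:
  assumes "X \<in> row_ball"
  shows "level_norm X k \<le> 1"
proof (induction k)
  case (Suc k)
  have X: "X i \<in> bounded_ops" for i
    using assms by (simp add: row_ball_def)
  have "level_norm X 1 \<le> 1"
    using assms unfolding level_norm_1 row_ball_def by simp
  then have "level_norm X 1 * level_norm X k \<le> 1 * 1"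
    by (intro mult_mono Suc) auto
  then show ?case
    using level_norm_add_le[of X 1 k, OF X] by simp
qed (rule level_norm_0_le)

section \<open>The joint spectral radius\<close>

text \<open>The joint spectral radius is defined with \<open>lim\<close>, which carries information
  only once convergence is known. As in Fekete's lemma, the limit is the infimum of the
  roots.\<close>

lemma Fekete_root_convergent:
  fixes s :: "nat \<Rightarrow> real"
  assumes nonneg: "\<And>k. 0 \<le> s k" and submult: "\<And>k l. s (k + l) \<le> s k * s l"
  shows "convergent (\<lambda>k. root k (s k))"
proof -
  \<comment> \<open>Index 0 is left out: \<open>root 0\<close> is 0 by convention and would spoil
    the infimum.\<close>
  define L where "L = Inf ((\<lambda>k. root k (s k)) ` {1..})"
  have bdd: "bdd_below ((\<lambda>k. root k (s k)) ` {1..})"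
    by (rule bdd_belowI[where m = 0]) (auto simp: nonneg)
  have pow: "s (q * m + r) \<le> s m ^ q * s r" for q m r
  proof (induction q)
    case (Suc q)
    have "s (Suc q * m + r) \<le> s m * s (q * m + r)"
      using submult[of m "q * m + r"] by (simp add: add.assoc)
    also have "\<dots> \<le> s m * (s m ^ q * s r)"
      by (intro mult_left_mono Suc nonneg)
    finally show ?case
      by (simp add: mult.assoc)
  qed simp
  have "(\<lambda>k. root k (s k)) \<longlonglongrightarrow> L"
  proof (rule order_tendstoI)
    fix a assume "a < L"
    have "a < root k (s k)" if "k \<ge> 1" for k
      using cInf_lower[OF _ bdd, of "root k (s k)"] that \<open>a < L\<close> by (force simp: L_def)
    then show "\<forall>\<^sub>F k in sequentially. a < root k (s k)"
      using eventually_sequentially by blast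
  next
    fix a assume "L < a"
    then obtain m where m: "m \<ge> 1" "root m (s m) < a"
      using cInf_lessD[of "(\<lambda>k. root k (s k)) ` {1..}" a] by (auto simp: L_def)
    then obtain b where b: "root m (s m) < b" "b < a"
      using dense by blast
    have "0 < b"
      using b(1) real_root_ge_zero[OF nonneg[of m], of m] by linarith
    have sm: "s m \<le> b ^ m"
    proof -
      have "s m = root m (s m) ^ m"
        using m(1) nonneg[of m] by simp
      also have "\<dots> \<le> b ^ m"
        using b(1) by (intro power_mono) (auto intro: real_root_ge_zero nonneg)
      finally show ?thesis .
    qed
    \<comment> \<open>With \<open>k = q * m + r\<close> and \<open>r < m\<close>, \<open>M\<close>
      bounds the contribution of the remainder for all \<open>r\<close> at once; the added 1 makes
      it positive, so that \<open>root k M\<close> tends to 1.\<close>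
    define M where "M = (\<Sum>r<m. s r / b ^ r) + 1"
    have "0 < M"
      unfolding M_def by (intro add_nonneg_pos sum_nonneg) (use \<open>0 < b\<close> nonneg in auto)
    have le: "s k \<le> b ^ k * M" for k
    proof -
      define q r where "q = k div m" and "r = k mod m"
      have k: "k = q * m + r"
        by (simp add: q_def r_def)
      have "r < m"
        using m(1) by (simp add: r_def)
      have "s k \<le> s m ^ q * s r"
        unfolding k by (rule pow)
      also have "\<dots> \<le> (b ^ m) ^ q * s r"
        by (intro mult_right_mono power_mono sm nonneg)
      also have "\<dots> = b ^ k * (s r / b ^ r)"
        using \<open>0 < b\<close> by (simp add: k power_add power_mult[symmetric] mult.commute)
      also have "\<dots> \<le> b ^ k * M"
      proof (rule mult_left_mono)
        have "s r / b ^ r \<le> (\<Sum>r<m. s r / b ^ r)"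
          using \<open>r < m\<close> \<open>0 < b\<close> nonneg by (intro member_le_sum) auto
        then show "s r / b ^ r \<le> M"
          by (simp add: M_def)
      qed (use \<open>0 < b\<close> in simp)
      finally show ?thesis .
    qed
    have "(\<lambda>k. b * root k M) \<longlonglongrightarrow> b * 1"
      by (intro tendsto_intros LIMSEQ_root_const \<open>0 < M\<close>)
    then have "\<forall>\<^sub>F k in sequentially. b * root k M < a"
      using b(2) by (intro order_tendstoD(2)) auto
    moreover have "\<forall>\<^sub>F k in sequentially. root k (s k) \<le> b * root k M"
      using eventually_gt_at_top[of "0::nat"]
    proof eventually_elim
      case (elim k)
      have "root k (s k) \<le> root k (b ^ k * M)"
        using elim le by simp
      also have "\<dots> = b * root k M"
        using elim \<open>0 < b\<close> by (simp add: real_root_mult real_root_power_cancel)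
      finally show ?case .
    qed
    ultimately show "\<forall>\<^sub>F k in sequentially. root k (s k) < a"
      by eventually_elim simp
  qed
  then show ?thesis
    by (rule convergentI)
qed

lemma root_less_imp_le_power:
  assumes "0 < k" "0 \<le> x" "root k x < c"
  shows "x \<le> c ^ k"
proof -
  have "x = root k x ^ k"
    using assms by simp
  also have "\<dots> \<le> c ^ k"
    using assms by (intro power_mono) auto
  finally show ?thesis .
qed

lemma root_double: "root (2 * k) x = root k (sqrt x)"
  using real_root_mult_exp[of k 2 x] by (simp only: sqrt_def mult.commute)

text \<open>Fekete is applied to the square roots, since \<open>root (2 * k)\<close> of the level
  norm is \<open>root k\<close> of its square root; any \<open>\<rho>\<close> strictly between the
  spectral radius and 1 then works.\<close>

lemma level_norm_decay:
  assumes "X \<in> C_inf_lt1"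
  obtains \<rho> where "0 < \<rho>" "\<rho> < 1" "\<forall>\<^sub>F k in sequentially. sqrt (level_norm X k) \<le> \<rho> ^ k"
proof -
  have X: "\<And>i. X i \<in> bounded_ops" and r: "joint_spectral_radius X < 1"
    using assms by (auto simp: C_inf_lt1_def)
  define s where "s k = sqrt (level_norm X k)" for k
  have "convergent (\<lambda>k. root k (s k))"
  proof (rule Fekete_root_convergent)
    show "s (k + l) \<le> s k * s l" for k l
      unfolding s_def using level_norm_add_le[OF X] by (simp flip: real_sqrt_mult)
  qed (simp add: s_def)
  then have "(\<lambda>k. root k (s k)) \<longlonglongrightarrow> joint_spectral_radius X"
    unfolding joint_spectral_radius_def root_double s_def level_norm_def
    by (simp add: convergent_LIMSEQ_iff)
  \<comment> \<open>The \<open>max 0\<close> yields a positive \<open>\<rho>\<close>, which later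
    serves as a divisor.\<close>
  moreover obtain \<rho> where \<rho>: "max 0 (joint_spectral_radius X) < \<rho>" "\<rho> < 1"
    using r dense[of "max 0 (joint_spectral_radius X)" 1] by auto
  ultimately have "\<forall>\<^sub>F k in sequentially. root k (s k) < \<rho>"
    by (intro order_tendstoD(2)) auto
  then have "\<forall>\<^sub>F k in sequentially. s k \<le> \<rho> ^ k"
    using eventually_gt_at_top[of "0::nat"]
    by eventually_elim (auto intro: root_less_imp_le_power simp: s_def)
  with \<rho> show thesis
    by (intro that[of \<rho>]) (auto simp: s_def)
qed

section \<open>Homogeneous parts of free holomorphic functions\<close>

definition hom_part ::
  "('n::finite list \<Rightarrow> complex) \<Rightarrow> nat \<Rightarrow> ('n \<Rightarrow> 'a::complex_inner \<Rightarrow>\<^sub>L 'a) \<Rightarrow> ('a \<Rightarrow>\<^sub>L 'a)" where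
  "hom_part a k X = (\<Sum>w | length w = k. scaleC_op (a w) (op_word X w))"

definition coeff_norm :: "('n::finite list \<Rightarrow> complex) \<Rightarrow> nat \<Rightarrow> real" where
  "coeff_norm a k = sqrt (\<Sum>w | length w = k. (cmod (a w))\<^sup>2)"

lemma coeff_norm_nonneg [simp]: "0 \<le> coeff_norm a k"
  by (simp add: coeff_norm_def sum_nonneg)

lemma fh_eval_eq: "fh_eval a X = (\<Sum>k. hom_part a k X)"
  by (simp add: fh_eval_def hom_part_def)

lemma hom_part_scaleR: "hom_part a k (\<lambda>i. r *\<^sub>R X i) = r ^ k *\<^sub>R hom_part a k X"
  unfolding hom_part_def scaleR_sum_right op_word_scaleR
  by (intro sum.cong refl) (simp add: scaleR_eq_scaleC_op mult.commute)

text \<open>Applied to \<open>x\<close>, the homogeneous part is the row of the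
  \<open>op_word X w\<close> acting on the column of the vectors \<open>a w *\<^sub>C x\<close>,
  whose norm is \<open>coeff_norm a k * norm x\<close>.\<close>

lemma norm_hom_part_le:
  assumes X: "\<And>i. X i \<in> bounded_ops"
  shows "norm (hom_part a k X) \<le> coeff_norm a k * sqrt (level_norm X k)"
proof (rule norm_blinfun_bound)
  fix x
  have c: "(coeff_norm a k)\<^sup>2 = (\<Sum>w | length w = k. (cmod (a w))\<^sup>2)"
    by (simp add: coeff_norm_def sum_nonneg)
  have "hom_part a k X x = (\<Sum>w | length w = k. op_word X w (a w *\<^sub>C x))"
    by (simp add: hom_part_def blinfun.sum_left bounded_opsD bounded_ops_op_word X)
  then have "(norm (hom_part a k X x))\<^sup>2
      \<le> level_norm X k * (\<Sum>w | length w = k. (norm (a w *\<^sub>C x))\<^sup>2)"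
    using level_norm_bound[where k = k and x = "\<lambda>w. a w *\<^sub>C x", OF X] by simp
  also have "\<dots> = (coeff_norm a k * sqrt (level_norm X k) * norm x)\<^sup>2"
    by (simp add: norm_scaleC power_mult_distrib c sum_distrib_left sum_distrib_right mult_ac)
  finally show "norm (hom_part a k X x) \<le> coeff_norm a k * sqrt (level_norm X k) * norm x"
    by (rule power2_le_imp_le) simp
qed simp

lemma coeff_norm_growth:
  assumes "free_holomorphic a" "1 < \<rho>"
  shows "\<forall>\<^sub>F k in sequentially. coeff_norm a k \<le> \<rho> ^ k"
proof -
  have "limsup (\<lambda>k. ereal (root (2 * k) (\<Sum>w | length w = k. (cmod (a w))\<^sup>2))) < ereal \<rho>"
    using assms by (auto simp: free_holomorphic_def intro: le_less_trans)
  then have "\<forall>\<^sub>F k in sequentially. root k (coeff_norm a k) < \<rho>"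
    by (auto dest!: Limsup_lessD simp: root_double coeff_norm_def)
  then show ?thesis
    using eventually_gt_at_top[of "0::nat"]
    by eventually_elim (auto intro: root_less_imp_le_power)
qed

text \<open>The coefficients grow at most like \<open>\<sigma> ^ k\<close> for every
  \<open>\<sigma> > 1\<close>, and \<open>\<sigma>\<close> can be taken so close to 1 that
  \<open>\<sigma> * \<rho> < 1\<close>. Used with powers of the dilation factor on the row ball and
  with the level norms of a tuple of small spectral radius.\<close>

lemma summable_coeff_norm:
  assumes a: "free_holomorphic a" and \<rho>: "0 < \<rho>" "\<rho> < 1"
    and s: "\<And>k. 0 \<le> s k" "\<forall>\<^sub>F k in sequentially. s k \<le> \<rho> ^ k"
  shows "summable (\<lambda>k. coeff_norm a k * s k)"
proof -
  obtain \<sigma> where \<sigma>: "1 < \<sigma>" "\<sigma> < 1 / \<rho>"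
    using dense[of 1 "1 / \<rho>"] \<rho> by auto
  show ?thesis
  proof (rule summable_comparison_test_ev)
    show "\<forall>\<^sub>F k in sequentially. norm (coeff_norm a k * s k) \<le> (\<sigma> * \<rho>) ^ k"
      using coeff_norm_growth[OF a \<sigma>(1)] s(2)
      by eventually_elim (use \<sigma>(1) in \<open>simp add: power_mult_distrib s(1) mult_mono\<close>)
    show "summable (\<lambda>k. (\<sigma> * \<rho>) ^ k)"
      using \<sigma> \<rho> by (intro summable_geometric) (simp add: field_simps abs_mult)
  qed
qed

section \<open>Noncommutative polynomials and their composition\<close>

text \<open>One matrix entry of a polynomial. A sum over an infinite support is 0 by convention, so
  the algebraic lemmas below assume finite support.\<close>

definition poly_op :: "('n list \<Rightarrow> complex) \<Rightarrow> ('n \<Rightarrow> 'a::complex_inner \<Rightarrow>\<^sub>L 'a) \<Rightarrow> ('a \<Rightarrow>\<^sub>L 'a)" where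
  "poly_op P X = (\<Sum>w | P w \<noteq> 0. scaleC_op (P w) (op_word X w))"

text \<open>Product in the free semigroup algebra. Test polynomials are families of coefficients, so
  products and composites must be formed on that level.\<close>

definition word_conv :: "('n list \<Rightarrow> complex) \<Rightarrow> ('n list \<Rightarrow> complex) \<Rightarrow> 'n list \<Rightarrow> complex" where
  "word_conv P Q w = (\<Sum>u | P u \<noteq> 0. \<Sum>v | Q v \<noteq> 0. if u @ v = w then P u * Q v else 0)"

primrec poly_word :: "('m \<Rightarrow> 'n list \<Rightarrow> complex) \<Rightarrow> 'm list \<Rightarrow> 'n list \<Rightarrow> complex" where
  "poly_word g [] = (\<lambda>w. if w = [] then 1 else 0)"
| "poly_word g (j # v) = word_conv (g j) (poly_word g v)"

definition poly_subst ::
  "('m list \<Rightarrow> complex) \<Rightarrow> ('m \<Rightarrow> 'n list \<Rightarrow> complex) \<Rightarrow> 'n list \<Rightarrow> complex" where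
  "poly_subst q g w = (\<Sum>v | q v \<noteq> 0. q v * poly_word g v w)"

lemma nc_poly_eval_eq: "nc_poly_eval M X i j = poly_op (\<lambda>w. M w i j) X"
  by (simp add: nc_poly_eval_def poly_op_def)

lemma poly_op_superset:
  assumes "finite S" "\<And>w. P w \<noteq> 0 \<Longrightarrow> w \<in> S"
  shows "poly_op P X = (\<Sum>w\<in>S. scaleC_op (P w) (op_word X w))"
  unfolding poly_op_def by (rule sum.mono_neutral_left) (use assms in auto)

lemma bounded_ops_poly_op: "(\<And>i. X i \<in> bounded_ops) \<Longrightarrow> poly_op P X \<in> bounded_ops"
  unfolding poly_op_def by (intro bounded_ops_sum bounded_ops_scaleC bounded_ops_op_word)

lemma bounded_ops_nc_poly_eval:
  "(\<And>i. X i \<in> bounded_ops) \<Longrightarrow> nc_poly_eval M X i j \<in> bounded_ops"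
  by (simp add: nc_poly_eval_eq bounded_ops_poly_op)

lemma poly_op_add:
  assumes "finite {w. P w \<noteq> 0}" "finite {w. Q w \<noteq> 0}"
  shows "poly_op (\<lambda>w. P w + Q w) X = poly_op P X + poly_op Q X"
proof -
  let ?S = "{w. P w \<noteq> 0} \<union> {w. Q w \<noteq> 0}"
  have S: "finite ?S"
    using assms by simp
  have "poly_op P X = (\<Sum>w\<in>?S. scaleC_op (P w) (op_word X w))"
    "poly_op Q X = (\<Sum>w\<in>?S. scaleC_op (Q w) (op_word X w))"
    "poly_op (\<lambda>w. P w + Q w) X = (\<Sum>w\<in>?S. scaleC_op (P w + Q w) (op_word X w))"
    by (rule poly_op_superset[OF S]; auto)+
  then show ?thesis
    by (simp add: scaleC_op_add_left sum.distrib)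
qed

lemma poly_op_scale: "poly_op (\<lambda>w. c * P w) X = scaleC_op c (poly_op P X)"
  by (cases "c = 0") (simp_all add: poly_op_def scaleC_op_sum_right)

lemma poly_op_const: "poly_op (\<lambda>w. if w = [] then c else 0) X = scaleC_op c id_blinfun"
  by (subst poly_op_superset[of "{[]}"]) (auto split: if_splits)

lemma word_conv_nonzero:
  assumes "word_conv P Q w \<noteq> 0"
  shows "w \<in> (\<lambda>(u, v). u @ v) ` ({u. P u \<noteq> 0} \<times> {v. Q v \<noteq> 0})"
proof (rule ccontr)
  assume "\<not> ?thesis"
  then have "word_conv P Q w = 0"
    unfolding word_conv_def by (intro sum.neutral ballI) auto
  with assms show False
    by simp
qed

lemma finite_word_conv:
  assumes "finite {u. P u \<noteq> 0}" "finite {v. Q v \<noteq> 0}"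
  shows "finite {w. word_conv P Q w \<noteq> 0}"
proof (rule finite_subset)
  show "{w. word_conv P Q w \<noteq> 0} \<subseteq> (\<lambda>(u, v). u @ v) ` ({u. P u \<noteq> 0} \<times> {v. Q v \<noteq> 0})"
    by (intro subsetI word_conv_nonzero, elim CollectE)
qed (use assms in simp)

text \<open>A word may factor as \<open>u @ v\<close> in several ways; exchanging the sums lets each
  pair \<open>(u, v)\<close> select its single word. Complex linearity of \<open>X\<close> allows
  the scalars \<open>Q v\<close> to pass through the composition.\<close>

lemma poly_op_word_conv:
  assumes P: "finite {u. P u \<noteq> 0}" and Q: "finite {v. Q v \<noteq> 0}" and X: "\<And>i. X i \<in> bounded_ops"
  shows "poly_op (word_conv P Q) X = poly_op P X o\<^sub>L poly_op Q X"
proof -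
  let ?S = "(\<lambda>(u, v). u @ v) ` ({u. P u \<noteq> 0} \<times> {v. Q v \<noteq> 0})"
  have S: "finite ?S"
    using P Q by simp
  have "poly_op (word_conv P Q) X = (\<Sum>w\<in>?S. scaleC_op (word_conv P Q w) (op_word X w))"
    by (rule poly_op_superset[OF S word_conv_nonzero])
  also have "\<dots> = (\<Sum>w\<in>?S. \<Sum>u | P u \<noteq> 0. \<Sum>v | Q v \<noteq> 0.
      if u @ v = w then scaleC_op (P u * Q v) (op_word X w) else 0)"
    unfolding word_conv_def scaleC_op_sum_left by (intro sum.cong refl) simp
  also have "\<dots> = (\<Sum>u | P u \<noteq> 0. \<Sum>v | Q v \<noteq> 0. \<Sum>w\<in>?S.
      if u @ v = w then scaleC_op (P u * Q v) (op_word X w) else 0)"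
    by (subst sum.swap, rule sum.cong[OF refl], rule sum.swap)
  also have "\<dots> = (\<Sum>u | P u \<noteq> 0. \<Sum>v | Q v \<noteq> 0. scaleC_op (P u * Q v) (op_word X (u @ v)))"
  proof (intro sum.cong refl)
    fix u v assume "u \<in> {u. P u \<noteq> 0}" "v \<in> {v. Q v \<noteq> 0}"
    then have "u @ v \<in> ?S"
      by auto
    then show "(\<Sum>w\<in>?S. if u @ v = w then scaleC_op (P u * Q v) (op_word X w) else 0)
        = scaleC_op (P u * Q v) (op_word X (u @ v))"
      using S by (simp add: sum.delta)
  qed
  also have "\<dots> = (\<Sum>u | P u \<noteq> 0. \<Sum>v | Q v \<noteq> 0.
      scaleC_op (P u) (op_word X u) o\<^sub>L scaleC_op (Q v) (op_word X v))"
    by (intro sum.cong refl)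
      (simp add: op_word_append scaleC_op_comp_left scaleC_op_comp_right bounded_ops_op_word X)
  also have "\<dots> = poly_op P X o\<^sub>L poly_op Q X"
    by (rule blinfun_eqI) (simp add: poly_op_def blinfun.sum_left blinfun.sum_right, rule sum.swap)
  finally show ?thesis .
qed

lemma finite_poly_word:
  assumes "\<And>j. finite {w. g j w \<noteq> 0}"
  shows "finite {w. poly_word g v w \<noteq> 0}"
proof (induction v)
  case Nil
  show ?case
    by (rule finite_subset[of _ "{[]}"]) (auto split: if_splits)
next
  case (Cons j v)
  then show ?case
    unfolding poly_word.simps by (intro finite_word_conv assms)
qed

lemma poly_op_poly_word:
  assumes g: "\<And>j. finite {w. g j w \<noteq> 0}" and X: "\<And>i. X i \<in> bounded_ops"
  shows "poly_op (poly_word g v) X = op_word (\<lambda>j. poly_op (g j) X) v"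
proof (induction v)
  case Nil
  show ?case
    by (simp add: poly_op_const)
next
  case (Cons j v)
  then show ?case
    unfolding poly_word.simps poly_op_word_conv[OF g finite_poly_word[OF g] X] op_word.simps by simp
qed

lemma poly_subst_nonzero:
  assumes "poly_subst q g w \<noteq> 0"
  shows "w \<in> (\<Union>v\<in>{v. q v \<noteq> 0}. {w. poly_word g v w \<noteq> 0})"
proof -
  obtain v where "v \<in> {v. q v \<noteq> 0}" "q v * poly_word g v w \<noteq> 0"
    by (rule sum.not_neutral_contains_not_neutral[OF assms[unfolded poly_subst_def]])
  then show ?thesis
    by (intro UN_I[of v]) simp_all
qed

lemma finite_poly_subst:
  assumes "finite {v. q v \<noteq> 0}" "\<And>j. finite {w. g j w \<noteq> 0}"
  shows "finite {w. poly_subst q g w \<noteq> 0}"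
proof (rule finite_subset)
  show "{w. poly_subst q g w \<noteq> 0} \<subseteq> (\<Union>v\<in>{v. q v \<noteq> 0}. {w. poly_word g v w \<noteq> 0})"
    by (intro subsetI poly_subst_nonzero, elim CollectE)
  show "finite (\<Union>v\<in>{v. q v \<noteq> 0}. {w. poly_word g v w \<noteq> 0})"
    by (intro finite_UN_I finite_poly_word assms)
qed

lemma poly_op_poly_subst:
  assumes q: "finite {v. q v \<noteq> 0}" and g: "\<And>j. finite {w. g j w \<noteq> 0}"
    and X: "\<And>i. X i \<in> bounded_ops"
  shows "poly_op (poly_subst q g) X = poly_op q (\<lambda>j. poly_op (g j) X)"
proof -
  let ?S = "\<Union>v\<in>{v. q v \<noteq> 0}. {w. poly_word g v w \<noteq> 0}"
  have S: "finite ?S"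
    by (intro finite_UN_I finite_poly_word g q)
  have "poly_op (poly_subst q g) X = (\<Sum>w\<in>?S. scaleC_op (poly_subst q g w) (op_word X w))"
    by (rule poly_op_superset[OF S poly_subst_nonzero])
  also have "\<dots> = (\<Sum>w\<in>?S. \<Sum>v | q v \<noteq> 0. scaleC_op (q v) (scaleC_op (poly_word g v w) (op_word X w)))"
    unfolding poly_subst_def scaleC_op_sum_left by simp
  also have "\<dots> = (\<Sum>v | q v \<noteq> 0. scaleC_op (q v) (\<Sum>w\<in>?S. scaleC_op (poly_word g v w) (op_word X w)))"
    unfolding scaleC_op_sum_right by (rule sum.swap)
  also have "\<dots> = (\<Sum>v | q v \<noteq> 0. scaleC_op (q v) (poly_op (poly_word g v) X))"
    by (intro sum.cong refl arg_cong[where f = "scaleC_op _"] poly_op_superset[symmetric] S) auto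
  also have "\<dots> = poly_op q (\<lambda>j. poly_op (g j) X)"
    by (simp add: poly_op_def[of q] poly_op_poly_word g X)
  finally show ?thesis .
qed

section \<open>Evaluation at zero, at scalar tuples and along convergent sequences\<close>

lemma op_word_zero: "op_word (\<lambda>_. 0) w = (if w = [] then id_blinfun else 0)"
  by (cases w) auto

lemma poly_op_zero:
  assumes "finite {w. P w \<noteq> 0}"
  shows "poly_op P (\<lambda>_. 0 :: 'a::complex_inner \<Rightarrow>\<^sub>L 'a) = scaleC_op (P []) id_blinfun"
proof -
  have "poly_op P (\<lambda>_. 0 :: 'a \<Rightarrow>\<^sub>L 'a)
      = (\<Sum>w | P w \<noteq> 0. if w = [] then scaleC_op (P []) id_blinfun else 0)"
    unfolding poly_op_def by (intro sum.cong refl) (simp add: op_word_zero)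
  also have "\<dots> = scaleC_op (P []) id_blinfun"
    by (simp add: sum.delta[OF assms])
  finally show ?thesis .
qed

lemma id_blinfun_comp [simp]: "id_blinfun o\<^sub>L T = T"
  by (rule blinfun_eqI) simp

lemma op_word_scalar:
  "op_word (\<lambda>j. scaleC_op (c j) id_blinfun :: 'a::complex_inner \<Rightarrow>\<^sub>L 'a) w
     = scaleC_op (prod_list (map c w)) id_blinfun"
  by (induction w) (simp_all add: scaleC_op_comp_left)

text \<open>At scalar tuples the variables commute and the value is a scalar polynomial times the
  identity; this makes holomorphy visible in \<open>test_poly_Harnack\<close>.\<close>

lemma poly_op_scalar:
  "poly_op P (\<lambda>j. scaleC_op (c j) id_blinfun :: 'a::complex_inner \<Rightarrow>\<^sub>L 'a)
     = scaleC_op (\<Sum>w | P w \<noteq> 0. P w * prod_list (map c w)) id_blinfun"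
  by (simp add: poly_op_def op_word_scalar scaleC_op_sum_left)

lemma tendsto_op_word:
  assumes "\<And>j. (\<lambda>n. X n j) \<longlonglongrightarrow> Y j"
  shows "(\<lambda>n. op_word (X n) w) \<longlonglongrightarrow> op_word Y w"
proof (induction w)
  case (Cons j w)
  then show ?case
    unfolding op_word.simps
    by (intro bounded_bilinear.tendsto[OF bounded_bilinear_blinfun_compose] assms)
qed simp

lemma tendsto_nc_poly_eval:
  assumes "\<And>j. (\<lambda>n. X n j) \<longlonglongrightarrow> Y j"
  shows "(\<lambda>n. nc_poly_eval M (X n) i j) \<longlonglongrightarrow> nc_poly_eval M Y i j"
  unfolding nc_poly_eval_def
  by (intro tendsto_sum bounded_linear.tendsto[OF bounded_linear_scaleC_op] tendsto_op_word assms)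

section \<open>Polynomial approximation of contractive free holomorphic functions\<close>

text \<open>Makes the operator spaces complete, so that norm-dominated series of operators
  converge.\<close>

instance chilbert_space \<subseteq> banach ..

text \<open>The truncated dilation \<open>(1 - \<eta>) f((1 - \<eta>) X)\<close>; the outer factor absorbs the truncation error,
  so that the approximants still map the row ball into itself.\<close>

definition fh_trunc :: "real \<Rightarrow> nat \<Rightarrow> ('n list \<Rightarrow> complex) \<Rightarrow> 'n list \<Rightarrow> complex" where
  "fh_trunc \<eta> N a w = (if length w < N then of_real ((1 - \<eta>) ^ Suc (length w)) * a w else 0)"

lemma finite_words_less [simp]: "finite {w :: 'n::finite list. length w < N}"
  by (rule finite_subset[OF _ finite_lists_length_le[of "UNIV :: 'n set" N]]) auto

lemma finite_fh_trunc [simp]: "finite {w :: 'n::finite list. fh_trunc \<eta> N a w \<noteq> 0}"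
  by (rule finite_subset[OF _ finite_words_less[of N]]) (auto simp: fh_trunc_def split: if_splits)

lemma poly_op_fh_trunc:
  "poly_op (fh_trunc \<eta> N a) X = (\<Sum>k<N. (1 - \<eta>) ^ Suc k *\<^sub>R hom_part a k X)"
proof -
  have "poly_op (fh_trunc \<eta> N a) X
      = (\<Sum>w | length w < N. scaleC_op (fh_trunc \<eta> N a w) (op_word X w))"
    by (rule poly_op_superset) (auto simp: fh_trunc_def split: if_splits)
  also have "\<dots> = (\<Sum>k<N. \<Sum>w | w \<in> {w. length w < N} \<and> length w = k.
      scaleC_op (fh_trunc \<eta> N a w) (op_word X w))"
    by (rule sum.group[symmetric]) auto
  also have "\<dots> = (\<Sum>k<N. \<Sum>w | length w = k.
      (1 - \<eta>) ^ Suc k *\<^sub>R scaleC_op (a w) (op_word X w))"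
    by (intro sum.cong) (auto simp: fh_trunc_def scaleR_eq_scaleC_op)
  finally show ?thesis
    by (simp add: hom_part_def scaleR_sum_right)
qed

lemma contractive_bound:
  fixes X :: "'n::finite \<Rightarrow> 'k::chilbert_space \<Rightarrow>\<^sub>L 'k" and a :: "'m::finite \<Rightarrow> 'n list \<Rightarrow> complex"
  assumes "contractive TYPE('k) a" "X \<in> row_ball"
  shows "norm (\<Sum>j\<in>UNIV. fh_eval (a j) X (x j)) \<le> L2_set (\<lambda>j. norm (x j)) UNIV"
proof -
  let ?R = "\<lambda>x :: 'k ^ 'm. \<Sum>j\<in>UNIV. fh_map a X j (x $ j)"
  have "bounded_linear ?R"
    by (intro bounded_linear_sum
        bounded_linear_compose[OF blinfun.bounded_linear_right bounded_linear_vec_nth])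
  then have "norm (?R (\<chi> j. x j)) \<le> onorm ?R * norm (\<chi> j. x j)"
    by (rule onorm)
  also have "\<dots> \<le> 1 * norm (\<chi> j. x j)"
    using assms by (intro mult_right_mono) (auto simp: contractive_def)
  finally show ?thesis
    by (simp add: fh_map_def norm_vec_def)
qed

lemma row_ball_scaleR:
  assumes X: "X \<in> row_ball" and r: "0 \<le> r" "r \<le> 1"
  shows "(\<lambda>i. r *\<^sub>R X i) \<in> row_ball"
proof -
  have b: "X i \<in> bounded_ops" for i
    using X by (simp add: row_ball_def)
  have "(\<Sum>i\<in>UNIV. (r *\<^sub>R X i) o\<^sub>L adj (r *\<^sub>R X i)) = r\<^sup>2 *\<^sub>R (\<Sum>i\<in>UNIV. X i o\<^sub>L adj (X i))"
    unfolding scaleR_sum_right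
    by (intro sum.cong refl)
      (simp add: scaleR_eq_scaleC_op adj_scaleC b scaleC_op_comp_left scaleC_op_comp_right power2_eq_square)
  moreover have "r\<^sup>2 * norm (\<Sum>i\<in>UNIV. X i o\<^sub>L adj (X i)) \<le> 1 * norm (\<Sum>i\<in>UNIV. X i o\<^sub>L adj (X i))"
    using r by (intro mult_right_mono) (auto simp: power_le_one)
  ultimately show ?thesis
    using X b by (simp add: row_ball_def bounded_ops_scaleR)
qed

lemma row_ballI:
  assumes Y: "\<And>j. Y j \<in> bounded_ops" and c: "0 \<le> c" "c < 1"
    and le: "\<And>x. norm (\<Sum>j\<in>UNIV. Y j (x j)) \<le> c * L2_set (\<lambda>j. norm (x j)) UNIV"
  shows "Y \<in> row_ball"
proof -
  have "norm (\<Sum>j\<in>UNIV. Y j o\<^sub>L adj (Y j)) \<le> c\<^sup>2"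
  proof (rule row_operator_bound_converse[OF Y])
    show "(norm (\<Sum>j\<in>UNIV. Y j (x j)))\<^sup>2 \<le> c\<^sup>2 * (\<Sum>j\<in>UNIV. (norm (x j))\<^sup>2)" for x
      using power_mono[OF le[of x] norm_ge_zero, of 2]
      by (simp add: power_mult_distrib L2_set_def sum_nonneg)
  qed simp
  moreover have "c\<^sup>2 < 1"
    using c by (simp add: power_less_one_iff abs_square_less_1)
  ultimately show ?thesis
    using Y by (simp add: row_ball_def)
qed

text \<open>At the dilated point \<open>Z\<close> the row of \<open>f\<close> is a contraction and
  the truncation error has row norm at most \<open>\<eta>\<close>. The outer factor
  \<open>1 - \<eta>\<close> brings the total down to
  \<open>(1 - \<eta>) * (1 + \<eta>) < 1\<close>.\<close>

lemma fh_trunc_row_ball: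
  fixes a :: "'m::finite \<Rightarrow> 'n::finite list \<Rightarrow> complex"
  assumes a: "\<And>j. free_holomorphic (a j)" and contr: "contractive TYPE('k::chilbert_space) a"
    and \<eta>: "0 < \<eta>" "\<eta> < 1"
  shows "\<forall>\<^sub>F N in sequentially. \<forall>X \<in> (row_ball :: ('n \<Rightarrow> 'k \<Rightarrow>\<^sub>L 'k) set).
           (\<lambda>j. poly_op (fh_trunc \<eta> N (a j)) X) \<in> row_ball"
proof -
  define r where "r = 1 - \<eta>"
  have r: "0 < r" "r < 1"
    using \<eta> by (simp_all add: r_def)
  \<comment> \<open>Each of the \<open>CARD('m)\<close> components is allowed an error of
    \<open>\<delta>\<close>, so together they contribute at most \<open>\<eta>\<close>.\<close>
  define \<delta> where "\<delta> = \<eta> / real CARD('m)"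
  have "0 < \<delta>"
    using \<eta> by (simp add: \<delta>_def)
  \<comment> \<open>A majorant of the degree \<open>k\<close> part at every dilated point of the
    ball; since it does not involve \<open>X\<close>, neither does the choice of
    \<open>N\<close>.\<close>
  define b where "b j k = coeff_norm (a j) k * r ^ k" for j k
  have sb: "summable (b j)" for j
    unfolding b_def by (rule summable_coeff_norm[OF a r]) (use r in auto)
  have "\<forall>\<^sub>F N in sequentially. suminf (b j) - \<delta> < (\<Sum>k<N. b j k)" for j
    using summable_LIMSEQ[OF sb[of j]] \<open>0 < \<delta>\<close> by (intro order_tendstoD(1)) auto
  then have "\<forall>\<^sub>F N in sequentially. \<forall>j. suminf (b j) - \<delta> < (\<Sum>k<N. b j k)"
    by (rule eventually_all_finite)
  then show ?thesis
  proof eventually_elim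
    case (elim N)
    show ?case
    proof
      fix X :: "'n \<Rightarrow> 'k \<Rightarrow>\<^sub>L 'k"
      assume X: "X \<in> row_ball"
      have Xb: "X i \<in> bounded_ops" for i
        using X by (simp add: row_ball_def)
      define Z where "Z i = r *\<^sub>R X i" for i
      have Z: "Z \<in> row_ball"
        unfolding Z_def using r by (intro row_ball_scaleR X) auto
      define D where "D j = fh_eval (a j) Z - (\<Sum>k<N. hom_part (a j) k Z)" for j
      have le_b: "norm (hom_part (a j) k Z) \<le> b j k" for j k
      proof -
        have "coeff_norm (a j) k * sqrt (level_norm X k) \<le> coeff_norm (a j) k * 1"
          using level_norm_row_ball[OF X] by (intro mult_left_mono) auto
        then have "norm (hom_part (a j) k X) \<le> coeff_norm (a j) k"
          using norm_hom_part_le[of X "a j" k, OF Xb] by linarith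
        then show ?thesis
          unfolding Z_def hom_part_scaleR b_def using r by (simp add: mult.commute mult_left_mono)
      qed
      have sh: "summable (\<lambda>k. hom_part (a j) k Z)" for j
        by (rule summable_comparison_test[OF _ sb[of j]]) (use le_b in blast)
      have D_le: "norm (D j) \<le> \<delta>" for j
      proof -
        have "D j = (\<Sum>k. hom_part (a j) (k + N) Z)"
          unfolding D_def fh_eval_eq by (subst suminf_split_initial_segment[OF sh, of _ N]) simp
        also have "norm \<dots> \<le> (\<Sum>k. b j (k + N))"
          by (rule norm_suminf_le[OF le_b summable_ignore_initial_segment[OF sb]])
        also have "\<dots> = suminf (b j) - (\<Sum>k<N. b j k)"
          by (rule suminf_minus_initial_segment[OF sb])
        also have "\<dots> \<le> \<delta>"
          using elim[rule_format, of j] by simp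
        finally show ?thesis .
      qed
      have g: "poly_op (fh_trunc \<eta> N (a j)) X = r *\<^sub>R (fh_eval (a j) Z - D j)" for j
        unfolding poly_op_fh_trunc D_def Z_def hom_part_scaleR by (simp add: r_def scaleR_sum_right)
      show "(\<lambda>j. poly_op (fh_trunc \<eta> N (a j)) X) \<in> row_ball"
      proof (rule row_ballI[where c = "r * (1 + \<eta>)"])
        show "poly_op (fh_trunc \<eta> N (a j)) X \<in> bounded_ops" for j
          by (rule bounded_ops_poly_op[OF Xb])
        show "0 \<le> r * (1 + \<eta>)"
          using r \<eta> by simp
        have "r * (1 + \<eta>) = 1 - \<eta>\<^sup>2"
          by (simp add: r_def power2_eq_square algebra_simps)
        then show "r * (1 + \<eta>) < 1"
          using \<eta> by simp
        fix x :: "'m \<Rightarrow> 'k"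
        let ?L = "L2_set (\<lambda>j. norm (x j)) UNIV"
        have "norm (\<Sum>j\<in>UNIV. D j (x j)) \<le> (\<Sum>j\<in>(UNIV :: 'm set). \<delta> * ?L)"
        proof (rule order_trans[OF norm_sum sum_mono])
          fix j
          have "norm (D j (x j)) \<le> norm (D j) * norm (x j)"
            by (rule norm_blinfun)
          also have "\<dots> \<le> \<delta> * ?L"
            using D_le[of j] \<open>0 < \<delta>\<close> by (intro mult_mono member_le_L2_set) auto
          finally show "norm (D j (x j)) \<le> \<delta> * ?L" .
        qed
        also have "\<dots> = \<eta> * ?L"
          by (simp add: \<delta>_def)
        finally have "norm ((\<Sum>j\<in>UNIV. fh_eval (a j) Z (x j)) - (\<Sum>j\<in>UNIV. D j (x j))) \<le> ?L + \<eta> * ?L"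
          by (intro norm_triangle_le_diff add_mono contractive_bound[OF contr Z])
        then have "r * norm ((\<Sum>j\<in>UNIV. fh_eval (a j) Z (x j)) - (\<Sum>j\<in>UNIV. D j (x j)))
            \<le> r * (?L + \<eta> * ?L)"
          using r by (intro mult_left_mono) auto
        also have "\<dots> = r * (1 + \<eta>) * ?L"
          by (simp add: algebra_simps)
        also have "r * norm ((\<Sum>j\<in>UNIV. fh_eval (a j) Z (x j)) - (\<Sum>j\<in>UNIV. D j (x j)))
            = norm (\<Sum>j\<in>UNIV. poly_op (fh_trunc \<eta> N (a j)) X (x j))"
          using r by (simp add: g blinfun.scaleR_left blinfun.diff_left sum_subtractf
              flip: scaleR_sum_right)
        finally show "norm (\<Sum>j\<in>UNIV. poly_op (fh_trunc \<eta> N (a j)) X (x j)) \<le> r * (1 + \<eta>) * ?L" .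
      qed
    qed
  qed
qed

text \<open>\<open>A\<close> need not lie in the row ball, so convergence rests on the geometric
  decay of its level norms, which dominates the series while cutoff and dilation vary
  together.\<close>

lemma fh_trunc_tendsto:
  fixes A :: "'n::finite \<Rightarrow> 'h::chilbert_space \<Rightarrow>\<^sub>L 'h"
  assumes a: "free_holomorphic a" and A: "A \<in> C_inf_lt1"
    and \<eta>: "\<eta> \<longlonglongrightarrow> 0" "\<And>n. 0 \<le> \<eta> n" "\<And>n. \<eta> n \<le> 1"
    and N: "\<And>n. n \<le> N n"
  shows "(\<lambda>n. poly_op (fh_trunc (\<eta> n) (N n) a) A) \<longlonglongrightarrow> fh_eval a A"
proof -
  obtain \<rho> where \<rho>: "0 < \<rho>" "\<rho> < 1" "\<forall>\<^sub>F k in sequentially. sqrt (level_norm A k) \<le> \<rho> ^ k"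
    using level_norm_decay[OF A] by blast
  define M where "M k = coeff_norm a k * sqrt (level_norm A k)" for k
  have M: "summable M"
    unfolding M_def by (rule summable_coeff_norm[OF a \<rho>(1,2) _ \<rho>(3)]) simp
  have le: "norm (hom_part a k A) \<le> M k" for k
    unfolding M_def by (rule norm_hom_part_le) (use A in \<open>simp add: C_inf_lt1_def\<close>)
  \<comment> \<open>Terms beyond the cutoff are set to 0, so that each approximant becomes a full
    series to which Tannery's theorem applies.\<close>
  define F where "F k n = (if k < N n then (1 - \<eta> n) ^ Suc k *\<^sub>R hom_part a k A else 0)" for k n
  have M_nonneg: "0 \<le> M k" for k
    by (simp add: M_def)
  have F_le: "norm (F k n) \<le> M k" for k n
  proof -
    have "\<bar>1 - \<eta> n\<bar> ^ Suc k * norm (hom_part a k A) \<le> 1 * M k"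
      using \<eta>(2,3)[of n] le[of k] by (intro mult_mono power_le_one) auto
    then show ?thesis
      using M_nonneg by (simp add: F_def power_abs abs_mult)
  qed
  have diff_le: "norm (F k n - hom_part a k A) \<le> 2 * M k" for k n
    using norm_triangle_ineq4[of "F k n" "hom_part a k A"] F_le[of k n] le[of k] by linarith
  have sF: "summable (\<lambda>k. F k n)" for n
    by (rule summable_comparison_test[OF _ M]) (use F_le in blast)
  have sh: "summable (\<lambda>k. hom_part a k A)"
    by (rule summable_comparison_test[OF _ M]) (use le in blast)
  have sum_F: "(\<Sum>k. F k n) = poly_op (fh_trunc (\<eta> n) (N n) a) A" for n
    unfolding poly_op_fh_trunc by (subst suminf_finite[of "{..<N n}"]) (auto simp: F_def)
  \<comment> \<open>Tannery's theorem is used for the real series of error norms, which in turn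
    dominates the error of the operator series.\<close>
  have "(\<lambda>n. \<Sum>k. norm (F k n - hom_part a k A)) \<longlonglongrightarrow> (\<Sum>k. 0)"
  proof (rule tannerys_theorem[THEN conjunct2, THEN conjunct2])
    show "(\<lambda>n. norm (F k n - hom_part a k A)) \<longlonglongrightarrow> 0" for k
    proof (rule Lim_transform_eventually)
      have "(\<lambda>n. norm ((1 - \<eta> n) ^ Suc k *\<^sub>R hom_part a k A - hom_part a k A))
          \<longlonglongrightarrow> norm ((1 - 0) ^ Suc k *\<^sub>R hom_part a k A - hom_part a k A)"
        by (intro tendsto_intros \<eta>(1))
      then show "(\<lambda>n. norm ((1 - \<eta> n) ^ Suc k *\<^sub>R hom_part a k A - hom_part a k A)) \<longlonglongrightarrow> 0"
        by simp
      show "\<forall>\<^sub>F n in sequentially.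
          norm ((1 - \<eta> n) ^ Suc k *\<^sub>R hom_part a k A - hom_part a k A) = norm (F k n - hom_part a k A)"
        using eventually_gt_at_top[of k]
        by eventually_elim (auto simp: F_def intro: less_le_trans[OF _ N])
    qed
    show "\<forall>\<^sub>F (k, n) in sequentially \<times>\<^sub>F sequentially.
        norm (norm (F k n - hom_part a k A)) \<le> 2 * M k"
      using diff_le by (intro always_eventually) auto
    show "summable (\<lambda>k. 2 * M k)"
      by (rule summable_mult[OF M])
  qed simp
  then have lim0: "(\<lambda>n. \<Sum>k. norm (F k n - hom_part a k A)) \<longlonglongrightarrow> 0"
    by simp
  have "(\<lambda>n. (\<Sum>k. F k n) - fh_eval a A) \<longlonglongrightarrow> 0"
  proof (rule Lim_null_comparison[OF always_eventually lim0], intro allI)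
    fix n
    have "summable (\<lambda>k. norm (F k n - hom_part a k A))"
      by (rule summable_comparison_test'[OF summable_mult[OF M, of 2]]) (use diff_le in simp)
    from summable_norm[OF this]
    show "norm ((\<Sum>k. F k n) - fh_eval a A) \<le> (\<Sum>k. norm (F k n - hom_part a k A))"
      by (simp add: fh_eval_eq suminf_diff[OF sF sh])
  qed
  then show ?thesis
    by (simp add: sum_F LIM_zero_iff)
qed

text \<open>The same coefficients serve both spaces: they preserve the row ball over
  \<open>'k\<close> and converge at tuples over \<open>'h\<close>. Constant coefficients do not
  grow, so the Harnack constant of \<open>f(0)\<close> remains valid for every approximant.\<close>

lemma fh_approximation:
  fixes a :: "'m::finite \<Rightarrow> 'n::finite list \<Rightarrow> complex"
  assumes a: "\<And>j. free_holomorphic (a j)" and contr: "contractive TYPE('k::chilbert_space) a"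
  obtains g where "\<And>n j. finite {w. g n j w \<noteq> 0}"
    "\<And>n j. cmod (g n j []) \<le> cmod (a j [])"
    "\<And>n X. X \<in> (row_ball :: ('n \<Rightarrow> 'k \<Rightarrow>\<^sub>L 'k) set) \<Longrightarrow> (\<lambda>j. poly_op (g n j) X) \<in> row_ball"
    "\<And>A j. A \<in> (C_inf_lt1 :: ('n \<Rightarrow> 'h::chilbert_space \<Rightarrow>\<^sub>L 'h) set) \<Longrightarrow>
       (\<lambda>n. poly_op (g n j) A) \<longlonglongrightarrow> fh_eval (a j) A"
proof -
  \<comment> \<open>The shift by 2 keeps \<open>\<eta> n\<close> strictly below 1 already at
    \<open>n = 0\<close>.\<close>
  define \<eta> :: "nat \<Rightarrow> real" where "\<eta> n = 1 / real (Suc (Suc n))" for n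
  have \<eta>: "0 < \<eta> n" "\<eta> n < 1" for n
    by (simp_all add: \<eta>_def)
  have "\<eta> \<longlonglongrightarrow> 0"
    unfolding \<eta>_def using LIMSEQ_Suc[OF LIMSEQ_inverse_real_of_nat] by (simp add: inverse_eq_divide)
  have "\<exists>N\<ge>n. \<forall>X \<in> (row_ball :: ('n \<Rightarrow> 'k \<Rightarrow>\<^sub>L 'k) set).
      (\<lambda>j. poly_op (fh_trunc (\<eta> n) N (a j)) X) \<in> row_ball" for n
    using eventually_conj[OF fh_trunc_row_ball[OF a contr \<eta>[of n]] eventually_ge_at_top[of n]]
    by (auto simp: eventually_sequentially)
  then obtain N where N: "\<And>n. n \<le> N n"
    "\<And>n X. X \<in> (row_ball :: ('n \<Rightarrow> 'k \<Rightarrow>\<^sub>L 'k) set) \<Longrightarrow>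
       (\<lambda>j. poly_op (fh_trunc (\<eta> n) (N n) (a j)) X) \<in> row_ball"
    by metis
  show thesis
  proof (rule that[of "\<lambda>n j. fh_trunc (\<eta> n) (N n) (a j)"])
    show "cmod (fh_trunc (\<eta> n) (N n) (a j) []) \<le> cmod (a j [])" for n j
      using \<eta>[of n] by (simp add: fh_trunc_def norm_mult mult_left_le_one_le del: of_real_diff)
    show "(\<lambda>n. poly_op (fh_trunc (\<eta> n) (N n) (a j)) A) \<longlonglongrightarrow> fh_eval (a j) A"
      if "A \<in> C_inf_lt1" for A :: "'n \<Rightarrow> 'h \<Rightarrow>\<^sub>L 'h" and j
      using \<eta> by (intro fh_trunc_tendsto a that \<open>\<eta> \<longlonglongrightarrow> 0\<close> N less_imp_le)
  qed (simp_all add: N(2))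
qed

section \<open>Harnack's inequality\<close>

text \<open>The Cayley transform \<open>f\<close> maps the right half plane into the disc and sends
  \<open>h 0\<close> to 0, so the Schwarz lemma gives
  \<open>norm (f \<xi>) \<le> norm \<xi>\<close>. What remains is to solve this for
  \<open>Re (h \<xi>)\<close>.\<close>

lemma Harnack_disc_strict:
  assumes h: "h holomorphic_on ball 0 1" and pos: "\<And>z. norm z < 1 \<Longrightarrow> 0 < Re (h z)"
    and \<xi>: "norm \<xi> < 1"
  shows "Re (h \<xi>) * (1 - norm \<xi>) \<le> Re (h 0) * (1 + norm \<xi>)"
proof -
  define c where "c = h 0"
  define f where "f z = (h z - c) / (h z + cnj c)" for z
  have c: "0 < Re c"
    using pos[of 0] by (simp add: c_def)
  have ne: "h z + cnj c \<noteq> 0" if "norm z < 1" for z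
  proof
    assume "h z + cnj c = 0"
    from arg_cong[OF this, of Re] show False
      using pos[OF that] c by simp
  qed
  have sq: "(cmod (h z + cnj c))\<^sup>2 - (cmod (h z - c))\<^sup>2 = 4 * (Re (h z) * Re c)" for z
    by (simp add: cmod_power2) (simp add: power2_eq_square algebra_simps)
  have f_less: "norm (f z) < 1" if z: "norm z < 1" for z
  proof -
    have "0 < 4 * (Re (h z) * Re c)"
      using pos[OF z] c by simp
    then have "(cmod (h z - c))\<^sup>2 < (cmod (h z + cnj c))\<^sup>2"
      using sq[of z] by linarith
    then have "cmod (h z - c) < cmod (h z + cnj c)"
      by (rule power_less_imp_less_base) simp
    then show ?thesis
      using ne[OF z] by (simp add: f_def norm_divide)
  qed
  have "f holomorphic_on ball 0 1"
    unfolding f_def using ne by (intro holomorphic_intros h) auto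
  then have "norm (f \<xi>) \<le> norm \<xi>"
    by (rule Schwarz_Lemma(1)) (use f_less \<xi> in \<open>auto simp: f_def c_def\<close>)
  then have "cmod (h \<xi> - c) \<le> norm \<xi> * cmod (h \<xi> + cnj c)"
    using ne[OF \<xi>] by (simp add: f_def norm_divide divide_le_eq)
  then have "(cmod (h \<xi> - c))\<^sup>2 \<le> (norm \<xi> * cmod (h \<xi> + cnj c))\<^sup>2"
    by (rule power_mono) simp
  then have le: "(Re (h \<xi>) - Re c)\<^sup>2 + (Im (h \<xi>) - Im c)\<^sup>2
      \<le> (norm \<xi>)\<^sup>2 * ((Re (h \<xi>) + Re c)\<^sup>2 + (Im (h \<xi>) - Im c)\<^sup>2)"
    by (simp add: power_mult_distrib cmod_power2)
  have "(norm \<xi>)\<^sup>2 * (Im (h \<xi>) - Im c)\<^sup>2 \<le> 1 * (Im (h \<xi>) - Im c)\<^sup>2"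
    using \<xi> by (intro mult_right_mono) (auto simp: power_le_one)
  with le have "(Re (h \<xi>) - Re c)\<^sup>2 \<le> (norm \<xi> * (Re (h \<xi>) + Re c))\<^sup>2"
    unfolding power_mult_distrib distrib_left[of "(norm \<xi>)\<^sup>2"] by linarith
  then have "Re (h \<xi>) - Re c \<le> norm \<xi> * (Re (h \<xi>) + Re c)"
    by (rule power2_le_imp_le) (use pos[OF \<xi>] c in simp)
  then show ?thesis
    by (simp add: c_def algebra_simps)
qed

lemma Harnack_disc:
  assumes h: "h holomorphic_on ball 0 1" and nonneg: "\<And>z. norm z < 1 \<Longrightarrow> 0 \<le> Re (h z)"
    and \<xi>: "norm \<xi> < 1"
  shows "Re (h \<xi>) \<le> (1 + norm \<xi>) / (1 - norm \<xi>) * Re (h 0)"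
proof (rule field_le_epsilon)
  fix e :: real assume e: "0 < e"
  define K where "K = (1 + norm \<xi>) / (1 - norm \<xi>)"
  have "0 < K"
    using \<xi> by (simp add: K_def add_pos_nonneg)
  \<comment> \<open>Adding \<open>d\<close> makes the real part strictly positive; this choice costs
    exactly \<open>K * d = e\<close>.\<close>
  define d where "d = e / K"
  have "0 < d"
    using e \<open>0 < K\<close> by (simp add: d_def)
  have "Re (h \<xi> + of_real d) * (1 - norm \<xi>) \<le> Re (h 0 + of_real d) * (1 + norm \<xi>)"
  proof (rule Harnack_disc_strict[OF _ _ \<xi>])
    show "(\<lambda>z. h z + of_real d) holomorphic_on ball 0 1"
      by (intro holomorphic_intros h)
    show "0 < Re (h z + of_real d)" if "norm z < 1" for z
      using nonneg[OF that] \<open>0 < d\<close> by simp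
  qed
  then have "Re (h \<xi>) + d \<le> K * (Re (h 0) + d)"
    using \<xi> by (simp add: K_def field_simps)
  also have "\<dots> = K * Re (h 0) + e"
    using \<open>0 < K\<close> by (simp add: d_def distrib_left)
  finally show "Re (h \<xi>) \<le> (1 + norm \<xi>) / (1 - norm \<xi>) * Re (h 0) + e"
    using \<open>0 < d\<close> by (simp add: K_def)
qed

section \<open>Quadratic forms of operator matrices and Harnack's inequality for test
  polynomials\<close>

definition op_matrix_form :: "nat \<Rightarrow> 'a::complex_inner op_matrix \<Rightarrow> (nat \<Rightarrow> 'a) \<Rightarrow> complex" where
  "op_matrix_form k T y = (\<Sum>i<k. cinner (\<Sum>j<k. T i j (y j)) (y i))"

text \<open>Reduces positivity of an operator matrix to a scalar inequality for each fixed vector.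
  The transposed index in \<open>op_matrix_Re\<close> is undone by exchanging the two sums.\<close>

lemma op_matrix_form_Re:
  assumes T: "\<And>i j. T i j \<in> bounded_ops"
  shows "op_matrix_form k (op_matrix_Re T) y = of_real (Re (op_matrix_form k T y))"
proof -
  have "(\<Sum>i<k. \<Sum>j<k. cinner (adj (T j i) (y j)) (y i))
      = (\<Sum>j<k. \<Sum>i<k. cinner (adj (T j i) (y j)) (y i))"
    by (rule sum.swap)
  also have "\<dots> = cnj (op_matrix_form k T y)"
    unfolding op_matrix_form_def cnj_sum cinner_sum_left
    by (intro sum.cong refl) (simp add: cinner_adj_left T, rule cinner_commute)
  finally have adj_form: "(\<Sum>i<k. \<Sum>j<k. cinner (adj (T j i) (y j)) (y i)) = cnj (op_matrix_form k T y)" .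
  have "op_matrix_form k (op_matrix_Re T) y = of_real (1/2) *
      ((\<Sum>i<k. \<Sum>j<k. cinner (adj (T j i) (y j)) (y i)) + op_matrix_form k T y)"
    by (simp only: op_matrix_form_def op_matrix_Re_def blinfun.scaleR_left blinfun.add_left
        cinner_sum_left cinner_scaleR_left cinner_add_left sum.distrib sum_distrib_left distrib_left)
  then show ?thesis
    unfolding adj_form
    by (simp add: complex_eq_iff)
qed

lemma op_matrix_nonneg_Re_iff:
  assumes "\<And>i j. T i j \<in> bounded_ops"
  shows "op_matrix_nonneg k (op_matrix_Re T) \<longleftrightarrow> (\<forall>y. 0 \<le> Re (op_matrix_form k T y))"
  unfolding op_matrix_nonneg_def op_matrix_form_def[symmetric] op_matrix_form_Re[OF assms] by simp

lemma op_matrix_form_cong: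
  "(\<And>i j. i < k \<Longrightarrow> j < k \<Longrightarrow> S i j = T i j) \<Longrightarrow> op_matrix_form k S y = op_matrix_form k T y"
  by (simp add: op_matrix_form_def)

lemma op_matrix_form_id:
  "op_matrix_form k (\<lambda>i j. if i = j then id_blinfun else 0) y = of_real (\<Sum>i<k. (norm (y i))\<^sup>2)"
proof -
  have "(\<Sum>j<k. (if i = j then id_blinfun else 0) (y j)) = y i" if "i < k" for i
  proof -
    have "(\<Sum>j<k. (if i = j then id_blinfun else 0) (y j)) = (\<Sum>j<k. if i = j then y j else 0)"
      by (intro sum.cong) auto
    then show ?thesis
      using that by simp
  qed
  then show ?thesis
    by (simp add: op_matrix_form_def cinner_self)
qed

abbreviation scalar_tuple :: "('n \<Rightarrow> complex) \<Rightarrow> 'n \<Rightarrow> 'a::complex_inner \<Rightarrow>\<^sub>L 'a" where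
  "scalar_tuple c \<equiv> \<lambda>j. scaleC_op (c j) id_blinfun"

lemma scalar_tuple_row_ball:
  fixes c :: "'n::finite \<Rightarrow> complex"
  assumes "L2_set (\<lambda>j. cmod (c j)) UNIV < 1"
  shows "scalar_tuple c \<in> (row_ball :: ('n \<Rightarrow> 'k::chilbert_space \<Rightarrow>\<^sub>L 'k) set)"
proof (rule row_ballI[OF _ L2_set_nonneg assms])
  fix x :: "'n \<Rightarrow> 'k"
  have "norm (\<Sum>j\<in>UNIV. scaleC_op (c j) id_blinfun (x j)) \<le> (\<Sum>j\<in>UNIV. \<bar>cmod (c j)\<bar> * \<bar>norm (x j)\<bar>)"
    by (rule order_trans[OF norm_sum]) (simp add: norm_scaleC)
  also have "\<dots> \<le> L2_set (\<lambda>j. cmod (c j)) UNIV * L2_set (\<lambda>j. norm (x j)) UNIV"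
    by (rule L2_set_mult_ineq)
  finally show "norm (\<Sum>j\<in>UNIV. scaleC_op (c j) id_blinfun (x j))
      \<le> L2_set (\<lambda>j. cmod (c j)) UNIV * L2_set (\<lambda>j. norm (x j)) UNIV" .
qed (simp add: bounded_ops_scaleC)

lemma holomorphic_on_prod_list:
  "(\<lambda>z. prod_list (map (\<lambda>j. z * c j) w)) holomorphic_on S"
  by (induction w) (auto intro!: holomorphic_intros)

text \<open>For a fixed \<open>y\<close>, the quadratic form along the disc through \<open>c\<close>
  is holomorphic with nonnegative real part, because scalar points of the Euclidean ball lie in the
  row ball.\<close>

lemma test_poly_Harnack:
  fixes c :: "'m::finite \<Rightarrow> complex"
  assumes M: "(k, M) \<in> test_polys TYPE('k::chilbert_space)"
    and c: "L2_set (\<lambda>j. cmod (c j)) UNIV < 1"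
  defines "L \<equiv> L2_set (\<lambda>j. cmod (c j)) UNIV"
  shows "Re (op_matrix_form k (nc_poly_eval M (scalar_tuple c :: 'm \<Rightarrow> 'k \<Rightarrow>\<^sub>L 'k)) y)
           \<le> (1 + L) / (1 - L) * (\<Sum>i<k. (norm (y i))\<^sup>2)"
proof -
  \<comment> \<open>The direction is normalised so that \<open>c\<close> sits at
    \<open>z = L\<close>. If \<open>L = 0\<close>, the quotient is 0 by convention, \<open>c\<close>
    vanishes and \<open>\<phi>\<close> is constant.\<close>
  define \<phi> where "\<phi> z = op_matrix_form k
      (nc_poly_eval M (scalar_tuple (\<lambda>j. z * (c j / of_real L)) :: 'm \<Rightarrow> 'k \<Rightarrow>\<^sub>L 'k)) y" for z
  have "0 \<le> L" "L < 1"
    using c by (simp_all add: L_def L2_set_nonneg)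
  have bops: "nc_poly_eval M (scalar_tuple c :: 'm \<Rightarrow> 'k \<Rightarrow>\<^sub>L 'k) i j \<in> bounded_ops" for c i j
    by (intro bounded_ops_nc_poly_eval bounded_ops_scaleC bounded_ops_id)
  have nonneg: "0 \<le> Re (\<phi> z)" if "norm z < 1" for z
  proof -
    have "L2_set (\<lambda>j. cmod (z * (c j / of_real L))) UNIV = L2_set (\<lambda>j. (norm z / L) * cmod (c j)) UNIV"
      using \<open>0 \<le> L\<close> by (simp add: norm_mult norm_divide)
    also have "\<dots> = (norm z / L) * L"
      unfolding L_def by (rule L2_set_right_distrib[symmetric]) (simp add: L2_set_nonneg)
    also have "\<dots> < 1"
      using that by (cases "L = 0") auto
    finally have "scalar_tuple (\<lambda>j. z * (c j / of_real L)) \<in> (row_ball :: ('m \<Rightarrow> 'k \<Rightarrow>\<^sub>L 'k) set)"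
      by (rule scalar_tuple_row_ball)
    then have "op_matrix_nonneg k
        (op_matrix_Re (nc_poly_eval M (scalar_tuple (\<lambda>j. z * (c j / of_real L)) :: 'm \<Rightarrow> 'k \<Rightarrow>\<^sub>L 'k)))"
      using M by (simp add: test_polys_def nc_poly_Re_def)
    then show ?thesis
      unfolding \<phi>_def op_matrix_nonneg_Re_iff[OF bops] by blast
  qed
  have "\<phi> z = (\<Sum>i<k. \<Sum>j<k. (\<Sum>w | M w i j \<noteq> 0.
      M w i j * prod_list (map (\<lambda>l. z * (c l / of_real L)) w)) * cinner (y j) (y i))" for z
    by (simp add: \<phi>_def op_matrix_form_def nc_poly_eval_eq poly_op_scalar cinner_sum_left cinner_scaleC_left)
  then have "\<phi> = (\<lambda>z. \<Sum>i<k. \<Sum>j<k. (\<Sum>w | M w i j \<noteq> 0.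
      M w i j * prod_list (map (\<lambda>l. z * (c l / of_real L)) w)) * cinner (y j) (y i))"
    by (rule ext)
  then have hol: "\<phi> holomorphic_on ball 0 1"
    by (simp only:) (intro holomorphic_intros holomorphic_on_prod_list)
  have "Re (\<phi> (of_real L)) \<le> (1 + L) / (1 - L) * Re (\<phi> 0)"
    using Harnack_disc[OF hol nonneg, of "of_real L"] \<open>0 \<le> L\<close> \<open>L < 1\<close> by simp
  moreover have "\<phi> (of_real L)
      = op_matrix_form k (nc_poly_eval M (scalar_tuple c :: 'm \<Rightarrow> 'k \<Rightarrow>\<^sub>L 'k)) y"
  proof -
    have "of_real L * (c j / of_real L) = c j" for j
    proof (cases "L = 0")
      case True
      then have "c j = 0"
        by (simp add: L_def L2_set_eq_0_iff)
      then show ?thesis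
        by simp
    qed simp
    then show ?thesis
      by (simp add: \<phi>_def)
  qed
  \<comment> \<open>Only the real part of a test polynomial is prescribed at 0, so this is all that
    is known about \<open>\<phi> 0\<close>.\<close>
  moreover have "Re (\<phi> 0) = (\<Sum>i<k. (norm (y i))\<^sup>2)"
  proof -
    have zero: "nc_poly_eval M (\<lambda>_. 0 :: 'k \<Rightarrow>\<^sub>L 'k) i j \<in> bounded_ops" for i j
      by (rule bounded_ops_nc_poly_eval) simp
    have "complex_of_real (Re (\<phi> 0)) = op_matrix_form k (nc_poly_Re M (\<lambda>_. 0 :: 'k \<Rightarrow>\<^sub>L 'k)) y"
      by (simp add: \<phi>_def nc_poly_Re_def op_matrix_form_Re[OF zero])
    also have "\<dots> = op_matrix_form k (\<lambda>i j. if i = j then id_blinfun else 0) y"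
      by (rule op_matrix_form_cong) (use M in \<open>simp add: test_polys_def\<close>)
    finally show ?thesis
      unfolding op_matrix_form_id of_real_eq_iff .
  qed
  ultimately show ?thesis
    by simp
qed

section \<open>Composition with a test polynomial\<close>

text \<open>\<open>poly_subst (\<lambda>v. M v i j) g []\<close> is the entry of
  \<open>q(g(0))\<close>. The correction alters only the empty word; it removes all of
  \<open>q(g(0))\<close>, including its skew-adjoint part, so the value at 0 is exactly the identity
  matrix.\<close>

definition renormalised_subst :: "real \<Rightarrow> ('m list \<Rightarrow> nat \<Rightarrow> nat \<Rightarrow> complex) \<Rightarrow>
    ('m \<Rightarrow> 'n list \<Rightarrow> complex) \<Rightarrow> 'n list \<Rightarrow> nat \<Rightarrow> nat \<Rightarrow> complex" where
  "renormalised_subst c M g w i j = of_real (1 / c) * (poly_subst (\<lambda>v. M v i j) g w +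
     (if w = [] then (if i = j then of_real c else 0) - poly_subst (\<lambda>v. M v i j) g [] else 0))"

lemma nc_poly_finite:
  assumes "nc_poly k M" "i < k" "j < k"
  shows "finite {w. M w i j \<noteq> 0}"
  by (rule finite_subset[OF _ assms(1)[unfolded nc_poly_def]]) (use assms in auto)

lemma finite_const_coeff: "finite {w. (if w = [] then z else 0) \<noteq> (0 :: complex)}"
  by (rule finite_subset[of _ "{[]}"]) (auto split: if_splits)

lemma nc_poly_eval_renormalised_subst:
  fixes X :: "'n \<Rightarrow> 'a::chilbert_space \<Rightarrow>\<^sub>L 'a"
  assumes M: "nc_poly k M" "i < k" "j < k" and g: "\<And>l. finite {w. g l w \<noteq> 0}"
    and X: "\<And>l. X l \<in> bounded_ops"
  shows "nc_poly_eval (renormalised_subst c M g) X i j = scaleC_op (of_real (1 / c))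
    (nc_poly_eval M (\<lambda>l. poly_op (g l) X) i j +
      (scaleC_op (if i = j then of_real c else 0) id_blinfun
        - nc_poly_eval M (scalar_tuple (\<lambda>l. g l [])) i j))"
proof -
  have M': "finite {v. M v i j \<noteq> 0}"
    by (rule nc_poly_finite[OF M])
  \<comment> \<open>Evaluating the composite at 0 in two ways identifies its constant coefficient
    with the value of \<open>M\<close> at \<open>g(0)\<close>.\<close>
  have "nc_poly_eval M (scalar_tuple (\<lambda>l. g l []) :: _ \<Rightarrow> 'a \<Rightarrow>\<^sub>L 'a) i j
      = poly_op (poly_subst (\<lambda>v. M v i j) g) (\<lambda>_. 0)"
    unfolding nc_poly_eval_eq by (subst poly_op_poly_subst[OF M' g]) (simp_all add: poly_op_zero g)
  also have "\<dots> = scaleC_op (poly_subst (\<lambda>v. M v i j) g []) id_blinfun"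
    by (rule poly_op_zero[OF finite_poly_subst[OF M' g]])
  finally have const: "nc_poly_eval M (scalar_tuple (\<lambda>l. g l []) :: _ \<Rightarrow> 'a \<Rightarrow>\<^sub>L 'a) i j
      = scaleC_op (poly_subst (\<lambda>v. M v i j) g []) id_blinfun" .
  show ?thesis
    unfolding const nc_poly_eval_eq[of "renormalised_subst c M g"] nc_poly_eval_eq[of M "\<lambda>l. poly_op (g l) X"]
      renormalised_subst_def poly_op_scale
      poly_op_add[OF finite_poly_subst[OF M' g] finite_const_coeff] poly_op_const
      poly_op_poly_subst[OF M' g X] scaleC_op_diff_left ..
qed

text \<open>The form of \<open>p\<close> at \<open>X\<close> is, up to the factor
  \<open>1 / c\<close>, that of \<open>q(g(X))\<close> plus that of \<open>c - q(g(0))\<close>. The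
  first has nonnegative real part because \<open>g\<close> preserves the ball, the second by
  Harnack.\<close>

lemma renormalised_subst_test_poly:
  fixes g :: "'m::finite \<Rightarrow> 'n::finite list \<Rightarrow> complex"
  assumes M: "(k, M) \<in> test_polys TYPE('k::chilbert_space)"
    and g: "\<And>j. finite {w. g j w \<noteq> 0}"
    and ball: "\<And>X. X \<in> (row_ball :: ('n \<Rightarrow> 'k \<Rightarrow>\<^sub>L 'k) set) \<Longrightarrow> (\<lambda>j. poly_op (g j) X) \<in> row_ball"
    and L: "L2_set (\<lambda>j. cmod (g j [])) UNIV \<le> L" "L < 1"
  shows "(k, renormalised_subst ((1 + L) / (1 - L)) M g) \<in> test_polys TYPE('k)"
proof -
  define c where "c = (1 + L) / (1 - L)"
  define p where "p = renormalised_subst c M g"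
  \<comment> \<open>Harnack applies with the true norm of \<open>g(0)\<close>; its constant
    increases with the norm, so the one for the common bound \<open>L\<close> works as well.\<close>
  define L' where "L' = L2_set (\<lambda>j. cmod (g j [])) UNIV"
  have L': "0 \<le> L'" "L' \<le> L" "L' < 1"
    using L by (simp_all add: L'_def L2_set_nonneg)
  have "0 < c"
    using L' L by (simp add: c_def)
  have k: "0 < k" and nc: "nc_poly k M"
    using M by (auto simp: test_polys_def)
  have pX: "nc_poly_eval p X i j = scaleC_op (of_real (1 / c))
      (nc_poly_eval M (\<lambda>l. poly_op (g l) X) i j + (scaleC_op (if i = j then of_real c else 0) id_blinfun
        - nc_poly_eval M (scalar_tuple (\<lambda>l. g l [])) i j))"
    if "i < k" "j < k" "\<And>l. X l \<in> bounded_ops" for i j and X :: "'n \<Rightarrow> 'k \<Rightarrow>\<^sub>L 'k"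
    unfolding p_def by (rule nc_poly_eval_renormalised_subst[OF nc that(1,2) g that(3)])
  have "nc_poly k p"
  proof -
    have "finite {w. p w i j \<noteq> 0}" if "i < k" "j < k" for i j
    proof (rule finite_subset)
      show "{w. p w i j \<noteq> 0} \<subseteq> {w. poly_subst (\<lambda>v. M v i j) g w \<noteq> 0} \<union> {[]}"
        by (auto simp: p_def renormalised_subst_def split: if_splits)
    qed (use finite_poly_subst[OF nc_poly_finite[OF nc that] g] in simp)
    then have "finite (\<Union>i<k. \<Union>j<k. {w. p w i j \<noteq> 0})"
      by simp
    then show ?thesis
      unfolding nc_poly_def by (rule rev_finite_subset) auto
  qed
  moreover have "nc_poly_Re p (\<lambda>_. 0 :: 'k \<Rightarrow>\<^sub>L 'k) i j = (if i = j then id_blinfun else 0)"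
    if "i < k" "j < k" for i j
  proof -
    have "nc_poly_eval p (\<lambda>_. 0 :: 'k \<Rightarrow>\<^sub>L 'k) i j = (if i = j then id_blinfun else 0)"
      if "i < k" "j < k" for i j
      using \<open>0 < c\<close> by (simp add: pX[OF that] poly_op_zero g)
    then show ?thesis
      using that by (simp add: nc_poly_Re_def op_matrix_Re_def flip: scaleR_2)
  qed
  moreover have "op_matrix_nonneg k (nc_poly_Re p X)"
    if X: "X \<in> row_ball" for X :: "'n \<Rightarrow> 'k \<Rightarrow>\<^sub>L 'k"
  proof -
    have Xb: "X l \<in> bounded_ops" for l
      using X by (simp add: row_ball_def)
    have "0 \<le> Re (op_matrix_form k (nc_poly_eval p X) y)" for y
    proof -
      let ?g = "\<lambda>l. poly_op (g l) X" and ?s = "scalar_tuple (\<lambda>l. g l []) :: 'm \<Rightarrow> 'k \<Rightarrow>\<^sub>L 'k"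
      let ?N = "\<Sum>i<k. (norm (y i))\<^sup>2"
      have "op_matrix_form k (nc_poly_eval p X) y = of_real (1 / c) *
          (op_matrix_form k (nc_poly_eval M ?g) y + (of_real (c * ?N)
            - op_matrix_form k (nc_poly_eval M ?s) y))"
      proof -
        have "op_matrix_form k (nc_poly_eval p X) y = op_matrix_form k (\<lambda>i j. scaleC_op (of_real (1 / c))
            (nc_poly_eval M ?g i j + (scaleC_op (of_real c) (if i = j then id_blinfun else 0)
              - nc_poly_eval M ?s i j))) y"
          by (rule op_matrix_form_cong) (simp add: pX[OF _ _ Xb])
        also have "\<dots> = of_real (1 / c) * (op_matrix_form k (nc_poly_eval M ?g) y +
            (of_real c * op_matrix_form k (\<lambda>i j. if i = j then id_blinfun else 0) y
            - op_matrix_form k (nc_poly_eval M ?s) y))"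
          by (simp only: op_matrix_form_def scaleC_op_apply blinfun.add_left blinfun.diff_left
              cinner_sum_left cinner_scaleC_left cinner_add_left cinner_diff_left
              sum.distrib sum_subtractf sum_distrib_left distrib_left right_diff_distrib)
        finally show ?thesis
          by (simp add: op_matrix_form_id)
      qed
      moreover have "0 \<le> Re (op_matrix_form k (nc_poly_eval M ?g) y)"
      proof -
        have "op_matrix_nonneg k (op_matrix_Re (nc_poly_eval M ?g))"
          using M ball[OF X] by (simp add: test_polys_def nc_poly_Re_def)
        then show ?thesis
          by (subst (asm) op_matrix_nonneg_Re_iff)
            (auto intro: bounded_ops_nc_poly_eval bounded_ops_poly_op Xb)
      qed
      moreover have "Re (op_matrix_form k (nc_poly_eval M ?s) y) \<le> c * ?N"
      proof -
        have "(1 + L') / (1 - L') \<le> c"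
          unfolding c_def using L' L(2) by (intro frac_le) auto
        then have "(1 + L') / (1 - L') * ?N \<le> c * ?N"
          by (intro mult_right_mono sum_nonneg) auto
        moreover have "Re (op_matrix_form k (nc_poly_eval M ?s) y) \<le> (1 + L') / (1 - L') * ?N"
          using test_poly_Harnack[OF M, of "\<lambda>l. g l []" y] L'(3) unfolding L'_def by blast
        ultimately show ?thesis
          by linarith
      qed
      ultimately show ?thesis
        using \<open>0 < c\<close> by simp
    qed
    then show ?thesis
      unfolding nc_poly_Re_def
      by (subst op_matrix_nonneg_Re_iff) (auto intro: bounded_ops_nc_poly_eval Xb)
  qed
  ultimately show ?thesis
    using k by (simp add: test_polys_def p_def c_def)
qed

section \<open>Operator matrix norms and the limit\<close>

text \<open>A real \<open>Sup\<close> dominates its elements only if the set is bounded above; the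
  sum of the entry norms is a crude bound.\<close>

lemma op_matrix_norm_upper:
  fixes T :: "'a::complex_inner op_matrix"
  assumes "(\<Sum>j<k. (norm (x j))\<^sup>2) \<le> 1"
  shows "sqrt (\<Sum>i<k. (norm (\<Sum>j<k. T i j (x j)))\<^sup>2) \<le> op_matrix_norm k T"
  unfolding op_matrix_norm_def
proof (rule cSup_upper)
  have "sqrt (\<Sum>i<k. (norm (\<Sum>j<k. T i j (x j)))\<^sup>2) \<le> (\<Sum>i<k. \<Sum>j<k. norm (T i j))"
    if x: "(\<Sum>j<k. (norm (x j))\<^sup>2) \<le> 1" for x
  proof -
    have x1: "norm (x j) \<le> 1" if "j < k" for j
    proof -
      have "(norm (x j))\<^sup>2 \<le> (\<Sum>j<k. (norm (x j))\<^sup>2)"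
        using that by (intro member_le_sum) auto
      then have "(norm (x j))\<^sup>2 \<le> 1\<^sup>2"
        using x by simp
      then show ?thesis
        by (rule power2_le_imp_le) simp
    qed
    have "sqrt (\<Sum>i<k. (norm (\<Sum>j<k. T i j (x j)))\<^sup>2) \<le> (\<Sum>i<k. norm (\<Sum>j<k. T i j (x j)))"
      using L2_set_le_sum[of "{..<k}" "\<lambda>i. norm (\<Sum>j<k. T i j (x j))"] by (simp add: L2_set_def)
    also have "\<dots> \<le> (\<Sum>i<k. \<Sum>j<k. norm (T i j))"
    proof (intro sum_mono order_trans[OF norm_sum])
      fix i j assume "j \<in> {..<k}"
      then have "norm (T i j) * norm (x j) \<le> norm (T i j) * 1"
        by (intro mult_left_mono x1) auto
      then show "norm (T i j (x j)) \<le> norm (T i j)"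
        using norm_blinfun[of "T i j" "x j"] by linarith
    qed
    finally show ?thesis .
  qed
  then show "bdd_above {sqrt (\<Sum>i<k. (norm (\<Sum>j<k. T i j (x j)))\<^sup>2) | x.
      (\<Sum>j<k. (norm (x j))\<^sup>2) \<le> 1}"
    by (intro bdd_aboveI[where M = "\<Sum>i<k. \<Sum>j<k. norm (T i j)"]) blast
qed (use assms in blast)

text \<open>Allows the final limit to be taken for one vector at a time. The bound is extended-real
  because \<open>d_K\<close> may be infinite, a case in which nothing has to be shown.\<close>

lemma ennreal_op_matrix_norm_le:
  fixes T :: "'a::complex_inner op_matrix"
  assumes "\<And>x. (\<Sum>j<k. (norm (x j))\<^sup>2) \<le> 1 \<Longrightarrow>
    ennreal (sqrt (\<Sum>i<k. (norm (\<Sum>j<k. T i j (x j)))\<^sup>2)) \<le> C"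
  shows "ennreal (op_matrix_norm k T) \<le> C"
proof (cases C)
  case (real r)
  have "op_matrix_norm k T \<le> r"
    unfolding op_matrix_norm_def
  proof (rule cSup_least)
    show "{sqrt (\<Sum>i<k. (norm (\<Sum>j<k. T i j (x j)))\<^sup>2) | x. (\<Sum>j<k. (norm (x j))\<^sup>2) \<le> 1} \<noteq> {}"
      by (simp, intro exI[of _ "\<lambda>_. 0"], simp)
  qed (use assms real in auto)
  then show ?thesis
    unfolding real(2) by (rule ennreal_leI)
qed simp

text \<open>Stated for the entries at \<open>(i, j)\<close> and \<open>(j, i)\<close> alone, since
  the proportionality is available only inside the \<open>k\<close> by \<open>k\<close>
  block.\<close>

lemma op_matrix_Re_affine_diff:
  assumes b: "S i j \<in> bounded_ops" "T i j \<in> bounded_ops" "S j i \<in> bounded_ops" "T j i \<in> bounded_ops"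
    and eq: "S' i j - T' i j = r *\<^sub>R (S i j - T i j)" "S' j i - T' j i = r *\<^sub>R (S j i - T j i)"
    and b': "S' j i \<in> bounded_ops" "T' j i \<in> bounded_ops"
  shows "op_matrix_Re S' i j - op_matrix_Re T' i j = r *\<^sub>R (op_matrix_Re S i j - op_matrix_Re T i j)"
proof -
  have "adj (S' j i) - adj (T' j i) = adj (r *\<^sub>R (S j i - T j i))"
    using b' by (simp add: adj_diff flip: eq)
  also have "\<dots> = r *\<^sub>R (adj (S j i) - adj (T j i))"
    by (simp add: scaleR_eq_scaleC_op adj_scaleC adj_diff bounded_ops_diff b)
  finally have "(adj (S' j i) - adj (T' j i)) + (S' i j - T' i j)
      = r *\<^sub>R ((adj (S j i) - adj (T j i)) + (S i j - T i j))"
    by (simp add: eq scaleR_add_right)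
  then have "(1/2) *\<^sub>R ((adj (S' j i) - adj (T' j i)) + (S' i j - T' i j))
      = r *\<^sub>R (1/2) *\<^sub>R ((adj (S j i) - adj (T j i)) + (S i j - T i j))"
    by simp
  then show ?thesis
    by (simp add: op_matrix_Re_def algebra_simps)
qed

text \<open>The theorem for a polynomial map \<open>g\<close>, tested on one vector so that it
  survives the passage to the limit.\<close>

lemma poly_substitution_bound:
  fixes g :: "'m::finite \<Rightarrow> 'n::finite list \<Rightarrow> complex"
    and A B :: "'n \<Rightarrow> 'h::chilbert_space \<Rightarrow>\<^sub>L 'h"
  assumes M: "(k, M) \<in> test_polys TYPE('k::chilbert_space)"
    and g: "\<And>j. finite {w. g j w \<noteq> 0}"
    and ball: "\<And>X. X \<in> (row_ball :: ('n \<Rightarrow> 'k \<Rightarrow>\<^sub>L 'k) set) \<Longrightarrow> (\<lambda>j. poly_op (g j) X) \<in> row_ball"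
    and L: "L2_set (\<lambda>j. cmod (g j [])) UNIV \<le> L" "L < 1"
    and A: "\<And>i. A i \<in> bounded_ops" and B: "\<And>i. B i \<in> bounded_ops"
    and x: "(\<Sum>j<k. (norm (x j))\<^sup>2) \<le> 1"
  shows "ennreal (sqrt (\<Sum>i<k. (norm (\<Sum>j<k. (nc_poly_Re M (\<lambda>l. poly_op (g l) A) i j
             - nc_poly_Re M (\<lambda>l. poly_op (g l) B) i j) (x j)))\<^sup>2))
           \<le> ennreal ((1 + L) / (1 - L)) * d_K TYPE('k) A B"
proof -
  define c where "c = (1 + L) / (1 - L)"
  define p where "p = renormalised_subst c M g"
  let ?gA = "\<lambda>l. poly_op (g l) A" and ?gB = "\<lambda>l. poly_op (g l) B"
  define D where "D i j = nc_poly_Re p A i j - nc_poly_Re p B i j" for i j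
  have "0 \<le> L"
    using L2_set_nonneg L(1) by (rule order_trans)
  then have "0 < c"
    using L(2) by (simp add: c_def add_pos_nonneg)
  have nc: "nc_poly k M"
    using M by (simp add: test_polys_def)
  have p_test: "(k, p) \<in> test_polys TYPE('k)"
    unfolding p_def c_def by (rule renormalised_subst_test_poly[OF M g ball L])
  \<comment> \<open>The constant added in \<open>p\<close> is the same at \<open>A\<close> and
    \<open>B\<close> and cancels; the division by \<open>c\<close> is what produces the
    factor.\<close>
  have eval: "nc_poly_eval M ?gA i j - nc_poly_eval M ?gB i j
      = c *\<^sub>R (nc_poly_eval p A i j - nc_poly_eval p B i j)" if "i < k" "j < k" for i j
    unfolding p_def nc_poly_eval_renormalised_subst[OF nc that g A]
      nc_poly_eval_renormalised_subst[OF nc that g B] scaleC_op_diff_right[symmetric]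
    using \<open>0 < c\<close> by (simp add: scaleR_eq_scaleC_op)
  have Re_eq: "nc_poly_Re M ?gA i j - nc_poly_Re M ?gB i j = c *\<^sub>R D i j" if "i < k" "j < k" for i j
    unfolding D_def nc_poly_Re_def
    by (rule op_matrix_Re_affine_diff)
      (use A B in \<open>simp_all add: eval that bounded_ops_nc_poly_eval bounded_ops_poly_op\<close>)
  have "sqrt (\<Sum>i<k. (norm (\<Sum>j<k. (nc_poly_Re M ?gA i j - nc_poly_Re M ?gB i j) (x j)))\<^sup>2)
      = sqrt (\<Sum>i<k. (norm (c *\<^sub>R (\<Sum>j<k. D i j (x j))))\<^sup>2)"
    by (simp add: Re_eq blinfun.scaleR_left scaleR_sum_right)
  also have "\<dots> = c * sqrt (\<Sum>i<k. (norm (\<Sum>j<k. D i j (x j)))\<^sup>2)"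
    using \<open>0 < c\<close> by (simp add: power_mult_distrib real_sqrt_mult flip: sum_distrib_left)
  also have "\<dots> \<le> c * op_matrix_norm k D"
    using \<open>0 < c\<close> by (intro mult_left_mono op_matrix_norm_upper x) simp
  finally have "ennreal (sqrt (\<Sum>i<k. (norm (\<Sum>j<k.
      (nc_poly_Re M ?gA i j - nc_poly_Re M ?gB i j) (x j)))\<^sup>2)) \<le> ennreal (c * op_matrix_norm k D)"
    by (rule ennreal_leI)
  also have "\<dots> = ennreal c * ennreal (op_matrix_norm k D)"
    using \<open>0 < c\<close> by (intro ennreal_mult') simp
  also have "ennreal (op_matrix_norm k D) \<le> d_K TYPE('k) A B"
    using SUP_upper[OF p_test, of "\<lambda>(k, M). ennreal (op_matrix_norm k (\<lambda>i j. nc_poly_Re M A i j - nc_poly_Re M B i j))"]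
    unfolding d_K_def D_def prod.case .
  finally show ?thesis
    by (simp add: c_def mult_left_mono)
qed

theorem theorem5p4:
  fixes a :: "'m::finite \<Rightarrow> 'n::finite list \<Rightarrow> complex"
    and A B :: "'n \<Rightarrow> 'h::chilbert_space \<Rightarrow>\<^sub>L 'h"
  assumes "separable_space (euclidean :: 'k::chilbert_space topology)"
    and "infinite_dimensional TYPE('k)"
    and "\<And>j. free_holomorphic (a j)"
    and "contractive TYPE('k) a"
    and "norm (fh_at_0 a) < 1"
    and "\<And>j. boundary_in_disc_algebra (a j)"
    and "A \<in> C_inf_lt1" and "B \<in> C_inf_lt1"
  shows "d_K TYPE('k) (fh_map a A) (fh_map a B)
           \<le> ennreal ((1 + norm (fh_at_0 a)) / (1 - norm (fh_at_0 a))) * d_K TYPE('k) A B"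
  unfolding d_K_def[of _ "fh_map a A" "fh_map a B"]
\<comment> \<open>With the test polynomial and the vector fixed, entrywise convergence of the
  operators is enough for the limit.\<close>
proof (rule SUP_least, clarify, rule ennreal_op_matrix_norm_le)
  fix k M and x :: "nat \<Rightarrow> 'h"
  assume M: "(k, M) \<in> (test_polys TYPE('k) :: (nat \<times> ('m list \<Rightarrow> _)) set)"
    and x: "(\<Sum>j<k. (norm (x j))\<^sup>2) \<le> 1"
  obtain g where g: "\<And>n j. finite {w. g n j w \<noteq> 0}"
    and g0: "\<And>n j. cmod (g n j []) \<le> cmod (a j [])"
    and ball: "\<And>n X. X \<in> (row_ball :: ('n \<Rightarrow> 'k \<Rightarrow>\<^sub>L 'k) set) \<Longrightarrow> (\<lambda>j. poly_op (g n j) X) \<in> row_ball"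
    and lim: "\<And>A j. A \<in> (C_inf_lt1 :: ('n \<Rightarrow> 'h \<Rightarrow>\<^sub>L 'h) set) \<Longrightarrow>
       (\<lambda>n. poly_op (g n j) A) \<longlonglongrightarrow> fh_eval (a j) A"
    using fh_approximation[OF assms(3,4), where ?'h = 'h] by metis
  \<comment> \<open>The bound does not depend on \<open>n\<close>, so one constant serves the whole
    approximating sequence.\<close>
  have L: "L2_set (\<lambda>j. cmod (g n j [])) UNIV \<le> norm (fh_at_0 a)" for n
    unfolding norm_vec_def fh_at_0_def by (intro L2_set_mono) (auto simp: g0)
  have lim_Re: "(\<lambda>n. nc_poly_Re M (\<lambda>l. poly_op (g n l) Z) i j) \<longlonglongrightarrow> nc_poly_Re M (fh_map a Z) i j"
    if Z: "Z \<in> C_inf_lt1" for Z :: "'n \<Rightarrow> 'h \<Rightarrow>\<^sub>L 'h" and i j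
  proof -
    have Zb: "Z l \<in> bounded_ops" for l
      using Z by (simp add: C_inf_lt1_def)
    have ev: "(\<lambda>n. nc_poly_eval M (\<lambda>l. poly_op (g n l) Z) i j) \<longlonglongrightarrow> nc_poly_eval M (fh_map a Z) i j"
      for i j
      unfolding fh_map_def by (intro tendsto_nc_poly_eval lim Z)
    show ?thesis
      unfolding nc_poly_Re_def op_matrix_Re_def
      by (intro tendsto_intros tendsto_adj ev bounded_ops_nc_poly_eval bounded_ops_poly_op Zb)
  qed
  have "(\<lambda>n. sqrt (\<Sum>i<k. (norm (\<Sum>j<k. (nc_poly_Re M (\<lambda>l. poly_op (g n l) A) i j
          - nc_poly_Re M (\<lambda>l. poly_op (g n l) B) i j) (x j)))\<^sup>2))
      \<longlonglongrightarrow> sqrt (\<Sum>i<k. (norm (\<Sum>j<k. (nc_poly_Re M (fh_map a A) i j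
          - nc_poly_Re M (fh_map a B) i j) (x j)))\<^sup>2)"
    by (intro tendsto_real_sqrt tendsto_sum tendsto_power tendsto_norm tendsto_blinfun_apply
        tendsto_diff lim_Re assms(7,8))
  from tendsto_ennrealI[OF this]
  show "ennreal (sqrt (\<Sum>i<k. (norm (\<Sum>j<k. (nc_poly_Re M (fh_map a A) i j
          - nc_poly_Re M (fh_map a B) i j) (x j)))\<^sup>2))
      \<le> ennreal ((1 + norm (fh_at_0 a)) / (1 - norm (fh_at_0 a))) * d_K TYPE('k) A B"
  proof (rule LIMSEQ_le_const2, intro exI allI impI)
    show "ennreal (sqrt (\<Sum>i<k. (norm (\<Sum>j<k. (nc_poly_Re M (\<lambda>l. poly_op (g n l) A) i j
          - nc_poly_Re M (\<lambda>l. poly_op (g n l) B) i j) (x j)))\<^sup>2))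
      \<le> ennreal ((1 + norm (fh_at_0 a)) / (1 - norm (fh_at_0 a))) * d_K TYPE('k) A B" for n
      by (rule poly_substitution_bound[OF M g ball L assms(5) _ _ x])
        (use assms(7,8) in \<open>auto simp: C_inf_lt1_def\<close>)
  qed
qed

end
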